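(* Let $X$ be a simplicial complex of dimension $2$, and let $s_2(X)$ be the number of its $2$-simplices. Then $$ s_2(X)\ge 2\log_3|\mathrm{Tors}\,H_1(X,\mathbb Z)| . $$ In particular, every group $G$ satisfies $$ \kappa(G)\ge 2\log_3|\mathrm{Tors}\,H_1(G,\mathbb Z)| . $$
   Context: All groups are finitely presentable and all simplicial complexes are finite. The simplicial complexity $\kappa(G)$ of a group $G$ is the minimal number of $2$-simplices of a connected simplicial complex of dimension at most $2$ with fundamental group $G$. $|\mathrm{Tors}\,A|$ denotes the number of torsion elements of an abelian group $A$. *)

theory Defs
  imports "HOL-Analysis.Analysis" "HOL-Algebra.Free_Abelian_Groups"
begin

section \<open>Homology of a chain complex of free abelian groups\<close>

text \<open>
  \<open>C n\<close> is the basis of the group of \<open>n\<close>-chains and \<open>d n\<close> the boundary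
  \<open>\<int>[C n] \<rightarrow> \<int>[C (n - 1)]\<close> on basis elements; \<open>d 0\<close> has to be \<open>0\<close>.
  The construction follows that of singular homology in HOL-Homology.
\<close>

definition chain_cycles :: "(nat \<Rightarrow> 'a set) \<Rightarrow> (nat \<Rightarrow> 'a \<Rightarrow> 'a \<Rightarrow>\<^sub>0 int) \<Rightarrow> nat \<Rightarrow> ('a \<Rightarrow>\<^sub>0 int) set" where
  "chain_cycles C d n = {c \<in> carrier (free_Abelian_group (C n)). frag_extend (d n) c = 0}"

definition chain_boundaries :: "(nat \<Rightarrow> 'a set) \<Rightarrow> (nat \<Rightarrow> 'a \<Rightarrow> 'a \<Rightarrow>\<^sub>0 int) \<Rightarrow> nat \<Rightarrow> ('a \<Rightarrow>\<^sub>0 int) set" where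
  "chain_boundaries C d n = frag_extend (d (Suc n)) ` carrier (free_Abelian_group (C (Suc n)))"

definition chain_homology :: "(nat \<Rightarrow> 'a set) \<Rightarrow> (nat \<Rightarrow> 'a \<Rightarrow> 'a \<Rightarrow>\<^sub>0 int) \<Rightarrow> nat \<Rightarrow> ('a \<Rightarrow>\<^sub>0 int) set monoid" where
  "chain_homology C d n =
     subgroup_generated (free_Abelian_group (C n)) (chain_cycles C d n) Mod chain_boundaries C d n"

definition torsion_elements :: "('a, 'm) monoid_scheme \<Rightarrow> 'a set" where
  "torsion_elements A = {x \<in> carrier A. \<exists>n::nat. n > 0 \<and> x [^]\<^bsub>A\<^esub> n = \<one>\<^bsub>A\<^esub>}"


section \<open>Finite simplicial complexes\<close>

text \<open>A complex is given by its set of nonempty simplices, a simplex by its set of vertices.\<close>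

definition finite_simplicial_complex :: "'v set set \<Rightarrow> bool" where
  "finite_simplicial_complex X \<longleftrightarrow> finite X \<and>
     (\<forall>\<sigma>\<in>X. finite \<sigma> \<and> \<sigma> \<noteq> {} \<and> (\<forall>\<tau>. \<tau> \<noteq> {} \<and> \<tau> \<subseteq> \<sigma> \<longrightarrow> \<tau> \<in> X))"

definition complex_simplices :: "'v set set \<Rightarrow> nat \<Rightarrow> 'v set set" where
  "complex_simplices X n = {\<sigma> \<in> X. card \<sigma> = n + 1}"

text \<open>The empty complex has dimension \<open>-1\<close>.\<close>

definition complex_dim :: "'v set set \<Rightarrow> int" where
  "complex_dim X = Max (insert (-1) ((\<lambda>\<sigma>. int (card \<sigma>) - 1) ` X))"

text \<open>
  The topology on the realization is that of pointwise convergence of barycentric coordinates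
  (the library's topology on function types); for finite complexes it is the usual one.
\<close>

definition complex_realization :: "'v set set \<Rightarrow> ('v \<Rightarrow> real) set" where
  "complex_realization X =
     {t. (\<forall>v. 0 \<le> t v) \<and> {v. t v \<noteq> 0} \<in> X \<and> sum t {v. t v \<noteq> 0} = 1}"

text \<open>
  Simplices are oriented by the order of the vertices: the exponent is the position of \<open>v\<close> in
  \<open>\<sigma>\<close>, so that \<open>[v\<^sub>0, \<dots>, v\<^sub>n]\<close> is mapped to the alternating sum of its faces
  \<open>[v\<^sub>0, \<dots>, v\<^sub>i\<^sub>-\<^sub>1, v\<^sub>i\<^sub>+\<^sub>1, \<dots>, v\<^sub>n]\<close>.
\<close>

definition simplicial_boundary :: "nat \<Rightarrow> 'v::linorder set \<Rightarrow> 'v set \<Rightarrow>\<^sub>0 int" where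
  "simplicial_boundary n \<sigma> =
     (if n = 0 then 0
      else (\<Sum>v\<in>\<sigma>. frag_cmul ((-1) ^ card {u \<in> \<sigma>. u < v}) (frag_of (\<sigma> - {v}))))"

definition simplicial_homology :: "nat \<Rightarrow> 'v::linorder set set \<Rightarrow> ('v set \<Rightarrow>\<^sub>0 int) set monoid" where
  "simplicial_homology n X = chain_homology (complex_simplices X) simplicial_boundary n"


section \<open>The fundamental group\<close>

definition loops_at :: "'a::topological_space set \<Rightarrow> 'a \<Rightarrow> (real \<Rightarrow> 'a) set" where
  "loops_at S a = {p. path p \<and> path_image p \<subseteq> S \<and> pathstart p = a \<and> pathfinish p = a}"

definition fundamental_group :: "'a::topological_space set \<Rightarrow> 'a \<Rightarrow> (real \<Rightarrow> 'a) set monoid" where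
  "fundamental_group S a =
     \<lparr>carrier = (\<lambda>p. Collect (homotopic_paths S p)) ` loops_at S a,
      monoid.mult = (\<lambda>P Q. {r. \<exists>p\<in>P. \<exists>q\<in>Q. homotopic_paths S (p +++ q) r}),
      one = Collect (homotopic_paths S (\<lambda>_. a))\<rparr>"


section \<open>Group homology\<close>

text \<open>The bar complex of \<open>G\<close> with trivial coefficients \<open>\<int>\<close>; the list \<open>[g\<^sub>1, \<dots>, g\<^sub>n]\<close> stands for \<open>[g\<^sub>1|\<dots>|g\<^sub>n]\<close>.\<close>

definition bar_basis :: "('a, 'm) monoid_scheme \<Rightarrow> nat \<Rightarrow> 'a list set" where
  "bar_basis G n = {gs. length gs = n \<and> set gs \<subseteq> carrier G}"

definition bar_boundary :: "('a, 'm) monoid_scheme \<Rightarrow> nat \<Rightarrow> 'a list \<Rightarrow> 'a list \<Rightarrow>\<^sub>0 int" where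
  "bar_boundary G n gs =
     (if n = 0 then 0
      else frag_of (tl gs)
         + (\<Sum>i\<in>{1..<n}. frag_cmul ((-1) ^ i)
              (frag_of (take (i - 1) gs @ [gs ! (i - 1) \<otimes>\<^bsub>G\<^esub> gs ! i] @ drop (i + 1) gs)))
         + frag_cmul ((-1) ^ n) (frag_of (butlast gs)))"

definition group_homology :: "nat \<Rightarrow> ('a, 'm) monoid_scheme \<Rightarrow> ('a list \<Rightarrow>\<^sub>0 int) set monoid" where
  "group_homology n G = chain_homology (bar_basis G) (bar_boundary G) n"


section \<open>Finitely presentable groups\<close>

text \<open>
  Words in the generators \<open>x\<^sub>0, \<dots>, x\<^sub>n\<^sub>-\<^sub>1\<close>; the letter \<open>(i, True)\<close> is \<open>x\<^sub>i\<close> and \<open>(i, False)\<close> its formal inverse.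
\<close>

definition group_words :: "nat \<Rightarrow> (nat \<times> bool) list set" where
  "group_words n = lists ({..<n} \<times> UNIV)"

inductive pres_eq :: "nat \<Rightarrow> (nat \<times> bool) list set \<Rightarrow> (nat \<times> bool) list \<Rightarrow> (nat \<times> bool) list \<Rightarrow> bool"
  for n :: nat and R :: "(nat \<times> bool) list set" where
  pres_refl: "w \<in> group_words n \<Longrightarrow> pres_eq n R w w"
| pres_sym: "pres_eq n R u w \<Longrightarrow> pres_eq n R w u"
| pres_trans: "pres_eq n R u v \<Longrightarrow> pres_eq n R v w \<Longrightarrow> pres_eq n R u w"
| pres_cancel: "u \<in> group_words n \<Longrightarrow> v \<in> group_words n \<Longrightarrow> i < n \<Longrightarrow>
    pres_eq n R (u @ [(i, b), (i, \<not> b)] @ v) (u @ v)"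
| pres_relator: "u \<in> group_words n \<Longrightarrow> v \<in> group_words n \<Longrightarrow> r \<in> R \<Longrightarrow>
    pres_eq n R (u @ r @ v) (u @ v)"

definition presented_group :: "nat \<Rightarrow> (nat \<times> bool) list set \<Rightarrow> (nat \<times> bool) list set monoid" where
  "presented_group n R =
     \<lparr>carrier = (\<lambda>w. Collect (pres_eq n R w)) ` group_words n,
      monoid.mult = (\<lambda>P Q. {w. \<exists>u\<in>P. \<exists>v\<in>Q. pres_eq n R (u @ v) w}),
      one = Collect (pres_eq n R [])\<rparr>"

definition finitely_presentable :: "('a, 'm) monoid_scheme \<Rightarrow> bool" where
  "finitely_presentable G \<longleftrightarrow>
     (\<exists>n R. finite R \<and> R \<subseteq> group_words n \<and> G \<cong> presented_group n R)"


section \<open>Simplicial complexity\<close>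

text \<open>
  Every finite complex is isomorphic to one with vertices in \<open>nat\<close>. The complex is nonempty because
  it has a base point. The minimum is taken in \<open>enat\<close>, hence would be \<open>\<infinity>\<close> if
  there were no such complex (there always is one when \<open>G\<close> is finitely presentable).
\<close>

definition simplicial_complexity :: "('a, 'm) monoid_scheme \<Rightarrow> enat" where
  "simplicial_complexity G =
     Inf {enat (card (complex_simplices X 2)) | X :: nat set set.
            finite_simplicial_complex X \<and> complex_dim X \<le> 2 \<and>
            connected (complex_realization X) \<and>
            (\<exists>a\<in>complex_realization X. fundamental_group (complex_realization X) a \<cong> G)}"

end

theory Submission
  imports Defs "Jordan_Normal_Form.Determinant" "HOL-Computational_Algebra.Primes"
begin

text \<open>
  The torsion of \<open>H\<^sub>1(X)\<close> is that of the cokernel of the boundary map from triangles to edges, whose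
  columns have Euclidean norm \<open>sqrt 3\<close>. A lattice spanned by the rows of a nonsingular integer
  matrix has index at most the absolute value of its determinant, and Hadamard's inequality bounds
  the latter by the product of the norms of the rows, so the torsion has order at most \<open>sqrt 3 ^ s\<^sub>2(X)\<close>.

  For the group version, \<open>H\<^sub>1(\<pi>\<^sub>1(X))\<close> has to be compared with \<open>H\<^sub>1(X)\<close>. A loop is sent to the
  monodromy of the covering of the realization of \<open>X\<close> defined by the cocycle of edges, with values
  in chains modulo boundaries. In the other direction an edge is closed up to a loop by paths from the
  base point. Coning off short pieces of a loop to vertices shows that the second map is a left
  inverse of the first, which is therefore injective on torsion.
\<close>

section \<open>Determinants and Hadamard's inequality\<close>

text \<open>Both inequalities come down to one count: a finite set of chains, each with a positive
  multiple among the boundaries and no two congruent modulo boundaries, has at most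
  \<open>sqrt 3 ^ s_2\<close> elements. The 3 is the number of edges of a triangle, each entering
  its boundary with coefficient 1 or -1; the factor 2 in front of the logarithm undoes the square
  root. For groups the obstacle is that the fundamental group consists of classes of continuous
  loops, which need not run along edges. A lift to the covering keeps track of how a chosen nearby
  vertex jumps along such a loop and adds up the edges of these jumps. Lifts exist because they
  exist over open stars and can be glued under bisection. An injection modulo boundaries is all that
  is aimed at: it carries incongruent torsion chains of the bar complex to incongruent torsion
  chains of edges, where the count applies.\<close>

definition rows_det :: "nat \<Rightarrow> (nat \<Rightarrow> nat \<Rightarrow> 'a) \<Rightarrow> 'a::comm_ring_1" where
  "rows_det n b = Determinant.det (Matrix.mat n n (\<lambda>(i, j). b i j))"

lemma rows_det_cong:
  assumes "\<And>i k. i < n \<Longrightarrow> k < n \<Longrightarrow> b i k = b' i k"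
  shows "rows_det n b = rows_det n b'"
  unfolding rows_det_def by (rule arg_cong[where f = Determinant.det]) (auto intro!: eq_matI assms)

text \<open>The cofactors along row \<open>j\<close> do not involve that row, so Laplace expansion
  with the cofactors of \<open>b\<close> itself shows that the determinant is linear in
  \<open>x\<close>.\<close>

lemma rows_det_update:
  assumes j: "j < n"
  shows "rows_det n (b(j := x))
       = (\<Sum>k<n. x k * cofactor (Matrix.mat n n (\<lambda>(i, j). b i j)) j k)"
proof -
  let ?A = "Matrix.mat n n (\<lambda>(i, k). (b(j := x)) i k)"
  have "rows_det n (b(j := x)) = (\<Sum>k<n. ?A $$ (j, k) * cofactor ?A j k)"
    unfolding rows_det_def by (rule laplace_expansion_row) (use j in auto)
  moreover have "cofactor ?A j k = cofactor (Matrix.mat n n (\<lambda>(i, j). b i j)) j k" if "k < n" for k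
  proof -
    have "mat_delete ?A j k = mat_delete (Matrix.mat n n (\<lambda>(i, j). b i j)) j k"
      unfolding mat_delete_def by (rule eq_matI) (use j that in auto)
    then show ?thesis
      by (simp add: cofactor_def)
  qed
  ultimately show ?thesis
    using j by simp
qed

lemma rows_det_equal_rows:
  assumes "i < n" "j < n" "i \<noteq> j" "\<And>k. k < n \<Longrightarrow> b i k = b j k"
  shows "rows_det n b = 0"
  unfolding rows_det_def
  by (rule det_identical_rows[of _ n i j]) (use assms in \<open>auto intro!: eq_vecI\<close>)

text \<open>By linearity in row \<open>j\<close>; every summand with \<open>i \<noteq> j\<close>
  repeats a row and vanishes.\<close>

lemma rows_det_lincomb:
  assumes j: "j < n" and x: "\<And>k. k < n \<Longrightarrow> x k = (\<Sum>i<n. c i * b i k)"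
  shows "rows_det n (b(j := x)) = c j * rows_det n b"
proof -
  let ?C = "cofactor (Matrix.mat n n (\<lambda>(i, j). b i j)) j"
  have zero: "rows_det n (b(j := b i)) = 0" if "i < n" "i \<noteq> j" for i
    by (rule rows_det_equal_rows[of i n j]) (use that j in auto)
  have "rows_det n (b(j := x)) = (\<Sum>k<n. (\<Sum>i<n. c i * b i k) * ?C k)"
    unfolding rows_det_update[OF j] by (intro sum.cong) (simp_all add: x)
  also have "\<dots> = (\<Sum>i<n. c i * (\<Sum>k<n. b i k * ?C k))"
    by (simp add: sum_distrib_left sum_distrib_right mult.assoc) (rule sum.swap)
  also have "\<dots> = (\<Sum>i<n. c i * rows_det n (b(j := b i)))"
    by (simp only: rows_det_update[OF j])
  also have "\<dots> = (\<Sum>i<n. if i = j then c j * rows_det n b else 0)"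
    using zero by (intro sum.cong) auto
  also have "\<dots> = c j * rows_det n b"
    using j by simp
  finally show ?thesis .
qed

text \<open>Cramer's rule without division: the identity \<open>adj A * A = det A * 1\<close>,
  paired with the vector \<open>x\<close>.\<close>

lemma rows_det_cramer:
  assumes l: "l < n"
  shows "(\<Sum>i<n. rows_det n (b(i := x)) * b i l) = rows_det n b * x l"
proof -
  let ?A = "Matrix.mat n n (\<lambda>(i, j). b i j)"
  have A: "?A \<in> carrier_mat n n"
    by simp
  have adj: "(\<Sum>i<n. cofactor ?A i k * b i l) = (if k = l then rows_det n b else 0)" if k: "k < n" for k
  proof -
    have "(adj_mat ?A * ?A) $$ (k, l) = (\<Sum>i<n. cofactor ?A i k * b i l)"
      using k l by (simp add: adj_mat_def scalar_prod_def lessThan_atLeast0)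
    also have "(adj_mat ?A * ?A) $$ (k, l) = (if k = l then rows_det n b else 0)"
      unfolding adj_mat(3)[OF A] rows_det_def using k l by auto
    finally show ?thesis
      by simp
  qed
  have "(\<Sum>i<n. rows_det n (b(i := x)) * b i l) = (\<Sum>i<n. \<Sum>k<n. x k * (cofactor ?A i k * b i l))"
    by (intro sum.cong refl) (simp add: rows_det_update sum_distrib_right mult.assoc)
  also have "\<dots> = (\<Sum>k<n. x k * (\<Sum>i<n. cofactor ?A i k * b i l))"
    by (subst sum.swap) (simp add: sum_distrib_left)
  also have "\<dots> = (\<Sum>k<n. if k = l then rows_det n b * x l else 0)"
    by (intro sum.cong) (auto simp: adj)
  also have "\<dots> = rows_det n b * x l"
    using l by simp
  finally show ?thesis .
qed

lemma rows_det_unit: "rows_det n (\<lambda>i k. if i = k then 1 else 0) = (1 :: 'a::comm_ring_1)"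
proof -
  have "Matrix.mat n n (\<lambda>(i, k). if i = k then 1 else 0) = (1\<^sub>m n :: 'a::comm_ring_1 mat)"
    by (rule eq_matI) auto
  then show ?thesis
    by (simp add: rows_det_def)
qed

text \<open>The Gram matrix of the rows is diagonal, and its determinant is the square of that of
  the matrix.\<close>

lemma rows_det_orthogonal:
  fixes b :: "nat \<Rightarrow> nat \<Rightarrow> 'a::idom"
  assumes "\<And>i j. i < n \<Longrightarrow> j < n \<Longrightarrow> i \<noteq> j \<Longrightarrow> (\<Sum>k<n. b i k * b j k) = 0"
  shows "(rows_det n b)\<^sup>2 = (\<Prod>i<n. \<Sum>k<n. b i k * b i k)"
proof -
  let ?A = "Matrix.mat n n (\<lambda>(i, j). b i j)"
  have A: "?A \<in> carrier_mat n n" "?A\<^sup>T \<in> carrier_mat n n"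
    by simp_all
  have entry: "(?A * ?A\<^sup>T) $$ (i, j) = (\<Sum>k<n. b i k * b j k)" if "i < n" "j < n" for i j
    using that by (simp add: scalar_prod_def lessThan_atLeast0)
  have "(rows_det n b)\<^sup>2 = Determinant.det (?A * ?A\<^sup>T)"
    by (simp add: det_mult[OF A] det_transpose[OF A(1)] rows_det_def power2_eq_square)
  also have "\<dots> = prod_list (diag_mat (?A * ?A\<^sup>T))"
    by (rule det_lower_triangular[where n = n])
      (use assms mult_carrier_mat[OF A] in \<open>simp_all add: entry del: index_mult_mat(1)\<close>)
  also have "\<dots> = (\<Prod>i<n. (?A * ?A\<^sup>T) $$ (i, i))"
    by (simp add: prod_list_diag_prod lessThan_atLeast0 del: index_mult_mat(1))
  also have "\<dots> = (\<Prod>i<n. \<Sum>k<n. b i k * b i k)"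
    by (intro prod.cong) (simp_all add: entry del: index_mult_mat(1))
  finally show ?thesis .
qed

text \<open>Gram-Schmidt without normalisation. Subtracting a combination of earlier rows from row
  \<open>m\<close> keeps the determinant, and by Pythagoras the remainder is no longer than the
  row.\<close>

lemma orthogonalize_rows:
  fixes b :: "nat \<Rightarrow> nat \<Rightarrow> real"
  assumes "m \<le> n"
  shows "\<exists>c. rows_det n c = rows_det n b
           \<and> (\<forall>i<n. (\<Sum>k<n. c i k * c i k) \<le> (\<Sum>k<n. b i k * b i k))
           \<and> (\<forall>i<m. \<forall>j<m. i \<noteq> j \<longrightarrow> (\<Sum>k<n. c i k * c j k) = 0)"
  using assms
proof (induction m)
  case 0
  then show ?case
    by auto
next
  case (Suc m)
  then obtain c where c: "rows_det n c = rows_det n b"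
      "\<And>i. i < n \<Longrightarrow> (\<Sum>k<n. c i k * c i k) \<le> (\<Sum>k<n. b i k * b i k)"
      "\<And>i j. i < m \<Longrightarrow> j < m \<Longrightarrow> i \<noteq> j \<Longrightarrow> (\<Sum>k<n. c i k * c j k) = 0"
    by auto
  have m: "m < n"
    using Suc.prems by simp
  define ip where "ip x y = (\<Sum>k<n. x k * y k)" for x y :: "nat \<Rightarrow> real"
  define a where "a i = ip (c m) (c i) / ip (c i) (c i)" for i
  define y where "y k = (\<Sum>i<m. a i * c i k)" for k
  define x where "x k = c m k - y k" for k
  have ip_commute: "ip u v = ip v u" for u v
    by (simp add: ip_def mult.commute)
  have ip_y: "ip y v = (\<Sum>i<m. a i * ip (c i) v)" for v
    unfolding ip_def y_def by (simp add: sum_distrib_left sum_distrib_right mult.assoc) (rule sum.swap)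
  have ip_x: "ip x v = ip (c m) v - ip y v" for v
    by (simp add: ip_def x_def left_diff_distrib sum_subtractf)
  \<comment> \<open>A row of norm 0 vanishes on all coordinates below \<open>n\<close>, so both
    sides are 0 whatever the division by 0 returns. Dependent rows are covered in this way.\<close>
  have a: "a j * ip (c j) (c j) = ip (c m) (c j)" for j
  proof (cases "ip (c j) (c j) = 0")
    case True
    then have "c j k = 0" if "k < n" for k
      using that by (auto simp: ip_def sum_nonneg_eq_0_iff)
    then show ?thesis
      by (simp add: ip_def)
  qed (simp add: a_def)
  have x_c: "ip x (c j) = 0" if j: "j < m" for j
  proof -
    have "ip y (c j) = (\<Sum>i<m. if i = j then a j * ip (c j) (c j) else 0)"
      unfolding ip_y by (intro sum.cong) (auto simp: c(3)[folded ip_def] j)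
    then show ?thesis
      using j by (simp add: ip_x a)
  qed
  have "ip y x = 0"
    unfolding ip_y by (simp add: x_c ip_commute[of _ x])
  have "ip (c m) (c m) = ip x x + ip y y"
  proof -
    have "ip (c m) v = ip x v + ip y v" for v
      by (simp add: ip_x)
    then show ?thesis
      using \<open>ip y x = 0\<close> by (metis add.left_neutral add.right_neutral ip_commute)
  qed
  moreover have "ip y y \<ge> 0"
    by (simp add: ip_def sum_nonneg)
  ultimately have le: "ip x x \<le> ip (c m) (c m)"
    by simp
  \<comment> \<open>The coefficients of \<open>x\<close> in the old rows. The one at row
    \<open>m\<close> is 1, and this is the factor by which the determinant changes.\<close>
  define w where "w i = (if i = m then 1 else if i < m then - a i else 0)" for i
  have "x k = (\<Sum>i<n. w i * c i k)" for k
  proof -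
    have "(\<Sum>i<n. w i * c i k) = (\<Sum>i<Suc m. w i * c i k)"
      using m by (intro sum.mono_neutral_right) (auto simp: w_def)
    also have "\<dots> = x k"
      by (simp add: w_def x_def y_def sum_negf)
    finally show ?thesis ..
  qed
  then have "rows_det n (c(m := x)) = w m * rows_det n c"
    by (intro rows_det_lincomb m)
  then have det: "rows_det n (c(m := x)) = rows_det n b"
    by (simp add: w_def c(1))
  show ?case
  proof (intro exI[of _ "c(m := x)"] conjI allI impI)
    fix i assume "i < n"
    then show "(\<Sum>k<n. (c(m := x)) i k * (c(m := x)) i k) \<le> (\<Sum>k<n. b i k * b i k)"
      using c(2)[of i] le by (auto simp: ip_def)
  next
    fix i j assume "i < Suc m" "j < Suc m" "i \<noteq> j"
    then show "(\<Sum>k<n. (c(m := x)) i k * (c(m := x)) j k) = 0"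
      using c(3)[of i j] x_c[of j] x_c[of i] by (auto simp: ip_def less_Suc_eq mult.commute)
  qed (rule det)
qed

lemma hadamard_inequality:
  fixes b :: "nat \<Rightarrow> nat \<Rightarrow> real"
  shows "(rows_det n b)\<^sup>2 \<le> (\<Prod>i<n. \<Sum>k<n. (b i k)\<^sup>2)"
proof -
  obtain c where c: "rows_det n c = rows_det n b"
      "\<And>i. i < n \<Longrightarrow> (\<Sum>k<n. c i k * c i k) \<le> (\<Sum>k<n. b i k * b i k)"
      "\<And>i j. i < n \<Longrightarrow> j < n \<Longrightarrow> i \<noteq> j \<Longrightarrow> (\<Sum>k<n. c i k * c j k) = 0"
    using orthogonalize_rows[of n n b] by auto
  have "(rows_det n b)\<^sup>2 = (\<Prod>i<n. \<Sum>k<n. c i k * c i k)"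
    unfolding c(1)[symmetric] by (rule rows_det_orthogonal) (rule c(3))
  also have "\<dots> \<le> (\<Prod>i<n. \<Sum>k<n. b i k * b i k)"
    by (intro prod_mono) (simp add: c(2) sum_nonneg)
  finally show ?thesis
    by (simp add: power2_eq_square)
qed

lemma rows_det_of_int: "rows_det n (\<lambda>i k. of_int (b i k)) = (of_int (rows_det n b) :: 'a::comm_ring_1)"
proof -
  have "Matrix.mat n n (\<lambda>(i, j). of_int (b i j)) = (map_mat of_int :: int mat \<Rightarrow> 'a mat) (Matrix.mat n n (\<lambda>(i, j). b i j))"
    by (rule eq_matI) auto
  then show ?thesis
    by (simp add: rows_det_def)
qed

section \<open>The index of an integer lattice\<close>

definition frag_det :: "nat \<Rightarrow> (nat \<Rightarrow> 'e) \<Rightarrow> (nat \<Rightarrow> 'e \<Rightarrow>\<^sub>0 int) \<Rightarrow> int" where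
  "frag_det n en b = rows_det n (\<lambda>i k. poly_mapping.lookup (b i) (en k))"

definition frag_span :: "nat \<Rightarrow> (nat \<Rightarrow> 'e \<Rightarrow>\<^sub>0 int) \<Rightarrow> ('e \<Rightarrow>\<^sub>0 int) set" where
  "frag_span n b = {\<Sum>i<n. frag_cmul (c i) (b i) | c. True}"

lemma frag_det_upd:
  "frag_det n en (b(j := x)) = rows_det n ((\<lambda>i k. poly_mapping.lookup (b i) (en k))(j := (\<lambda>k. poly_mapping.lookup x (en k))))"
  unfolding frag_det_def by (rule arg_cong[where f = "rows_det n"]) auto

lemma frag_det_lincomb:
  "j < n \<Longrightarrow> frag_det n en (b(j := \<Sum>i<n. frag_cmul (c i) (b i))) = c j * frag_det n en b"
  unfolding frag_det_upd by (subst rows_det_lincomb[where c = c]) (auto simp: lookup_sum frag_det_def)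

lemma frag_det_cmul:
  "j < n \<Longrightarrow> frag_det n en (b(j := frag_cmul p x)) = p * frag_det n en (b(j := x))"
  unfolding frag_det_upd by (simp add: rows_det_update sum_distrib_left mult.assoc)

lemma frag_det_independent:
  assumes "(\<Sum>i<n. frag_cmul (c i) (b i)) = 0" "frag_det n en b \<noteq> 0" "j < n"
  shows "c j = 0"
proof -
  \<comment> \<open>The vanishing combination is put in place of row \<open>j\<close>; written as
    \<open>frag_cmul 0 0\<close>, it lets the factor 0 be pulled out of the determinant.\<close>
  have "c j * frag_det n en b = frag_det n en (b(j := frag_cmul 0 0))"
    using frag_det_lincomb[OF assms(3), of en b c] assms(1) by simp
  also have "\<dots> = 0"
    by (subst frag_det_cmul[OF assms(3)]) simp
  finally show ?thesis
    using assms(2) by simp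
qed

lemma frag_det_equal_rows:
  assumes "i < n" "j < n" "i \<noteq> j" "b i = b j"
  shows "frag_det n en b = 0"
  unfolding frag_det_def by (rule rows_det_equal_rows[of i n j]) (use assms in auto)

text \<open>Serves twice: it shows that the determinant multiplies every chain into the lattice, and
  it gives the coefficients explicitly, so that some of them can be seen to vanish.\<close>

lemma frag_det_cramer:
  assumes en: "bij_betw en {..<n} E" and x: "Poly_Mapping.keys x \<subseteq> E" and b: "\<And>i. i < n \<Longrightarrow> Poly_Mapping.keys (b i) \<subseteq> E"
  shows "(\<Sum>i<n. frag_cmul (frag_det n en (b(i := x))) (b i)) = frag_cmul (frag_det n en b) x"
proof (rule poly_mapping_eqI)
  fix e
  show "poly_mapping.lookup (\<Sum>i<n. frag_cmul (frag_det n en (b(i := x))) (b i)) e = poly_mapping.lookup (frag_cmul (frag_det n en b) x) e"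
  proof (cases "e \<in> E")
    case True
    then obtain l where l: "l < n" "e = en l"
      using en by (auto simp: bij_betw_def)
    show ?thesis
      using rows_det_cramer[OF l(1), of "\<lambda>i k. poly_mapping.lookup (b i) (en k)" "\<lambda>k. poly_mapping.lookup x (en k)"]
      unfolding l(2) frag_det_upd by (simp add: lookup_sum frag_det_def)
  next
    case False
    then have "poly_mapping.lookup x e = 0" "poly_mapping.lookup (b i) e = 0" if "i < n" for i
      using x b[OF that] by (auto simp: in_keys_iff)
    moreover have "poly_mapping.lookup x e = 0"
      using False x by (auto simp: in_keys_iff)
    ultimately show ?thesis
      by (simp add: lookup_sum)
  qed
qed

lemma frag_spanI: "(\<Sum>i<n. frag_cmul (c i) (b i)) \<in> frag_span n b"
  unfolding frag_span_def by blast

lemma frag_span_diff: "x \<in> frag_span n b \<Longrightarrow> y \<in> frag_span n b \<Longrightarrow> x - y \<in> frag_span n b"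
proof -
  assume "x \<in> frag_span n b" "y \<in> frag_span n b"
  then obtain c d where "x = (\<Sum>i<n. frag_cmul (c i) (b i))" "y = (\<Sum>i<n. frag_cmul (d i) (b i))"
    by (auto simp: frag_span_def)
  then have "x - y = (\<Sum>i<n. frag_cmul (c i - d i) (b i))"
    by (simp add: frag_cmul_diff_distrib sum_subtractf)
  then show ?thesis
    by (simp add: frag_spanI)
qed

lemma frag_span_0: "0 \<in> frag_span n b"
  using frag_spanI[of "\<lambda>_. 0" b n] by simp

lemma frag_span_cmul: "x \<in> frag_span n b \<Longrightarrow> frag_cmul k x \<in> frag_span n b"
  by (rule frag_closure_minus_cmul) (auto intro: frag_span_0 frag_span_diff)

lemma frag_span_add: "x \<in> frag_span n b \<Longrightarrow> y \<in> frag_span n b \<Longrightarrow> x + y \<in> frag_span n b"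
  using frag_span_diff[of x n b "0 - y"] frag_span_diff[of 0 n b y] frag_span_0[of n b] by simp

lemma frag_span_sum: "(\<And>i. i \<in> I \<Longrightarrow> f i \<in> frag_span n b) \<Longrightarrow> sum f I \<in> frag_span n b"
  by (induction I rule: infinite_finite_induct) (auto intro: frag_span_0 frag_span_add)

lemma frag_span_superset: "j < n \<Longrightarrow> b j \<in> frag_span n b"
proof -
  assume "j < n"
  have "(\<Sum>i<n. frag_cmul (if i = j then 1 else 0) (b i)) = (\<Sum>i<n. if i = j then b i else 0)"
    by (intro sum.cong) auto
  also have "\<dots> = b j"
    using \<open>j < n\<close> by simp
  finally show ?thesis
    using frag_spanI by metis
qed

lemma frag_cmul_left_cancel: "k \<noteq> 0 \<Longrightarrow> frag_cmul k x = frag_cmul k y \<Longrightarrow> x = y"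
  by (metis frag_cmul_eq_0_iff frag_cmul_distrib2 eq_iff_diff_eq_0 diff_add_cancel add_cancel_left_left)

text \<open>Descent on \<open>N = p * m\<close> with \<open>p\<close> prime: either
  \<open>m x\<close> lies outside \<open>L\<close> and is the element wanted, or \<open>m\<close>
  takes the place of \<open>N\<close>.\<close>

lemma prime_order_element:
  assumes "frag_cmul (int N) x \<in> L" "N > 0" "x \<notin> L"
  shows "\<exists>p m. prime p \<and> frag_cmul (int m) x \<notin> L \<and> frag_cmul (int p) (frag_cmul (int m) x) \<in> L"
  using assms
proof (induction N rule: less_induct)
  case (less N)
  have "N \<noteq> 1"
    using less.prems by auto
  then obtain p m where p: "prime p" "N = p * m"
    using prime_factor_nat[of N] by (auto elim: dvdE)
  show ?case
  proof (cases "frag_cmul (int m) x \<in> L")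
    case True
    moreover have "m < N" "m > 0"
      using p less.prems(2) prime_gt_1_nat[OF p(1)] by auto
    ultimately show ?thesis
      using less.IH less.prems(3) by blast
  next
    case False
    then show ?thesis
      using p less.prems(1) by (intro exI[of _ p] exI[of _ m]) simp
  qed
qed

text \<open>Split \<open>F\<close> into classes modulo \<open>L\<close>. One representative from
  each class gives an incongruent set, so there are at most \<open>M\<close> classes, each with at
  most \<open>p\<close> elements.\<close>

lemma card_le_representatives:
  fixes F L :: "'a::ab_group_add set"
  assumes "finite F"
    and sub0: "0 \<in> L" and sub: "\<And>x y. x \<in> L \<Longrightarrow> y \<in> L \<Longrightarrow> x - y \<in> L"
    and reps: "\<And>R. R \<subseteq> F \<Longrightarrow> (\<And>x y. x \<in> R \<Longrightarrow> y \<in> R \<Longrightarrow> x - y \<in> L \<Longrightarrow> x = y) \<Longrightarrow> card R \<le> M"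
    and cls: "\<And>f. f \<in> F \<Longrightarrow> card {x \<in> F. x - f \<in> L} \<le> p"
  shows "card F \<le> M * (p::nat)"
proof -
  have sym: "y - x \<in> L" if "x - y \<in> L" for x y
    using sub[OF sub0 that] by simp
  have trans: "x - z \<in> L" if "x - y \<in> L" "y - z \<in> L" for x y z
    using sub[OF that(1) sym[OF that(2)]] by simp
  define r where "r x = (SOME y. y \<in> F \<and> x - y \<in> L)" for x
  have r: "r x \<in> F" "x - r x \<in> L" if "x \<in> F" for x
    using someI[of "\<lambda>y. y \<in> F \<and> x - y \<in> L" x] that sub0 by (auto simp: r_def)
  \<comment> \<open>Congruent elements have the same candidates for a representative, so
    \<open>SOME\<close> returns the same one for both.\<close>
  have r_eq: "r x = r y" if "x - y \<in> L" for x y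
  proof -
    have "(\<lambda>z. z \<in> F \<and> x - z \<in> L) = (\<lambda>z. z \<in> F \<and> y - z \<in> L)"
      using trans[OF that] trans[OF sym[OF that]] by blast
    then show ?thesis
      by (simp add: r_def)
  qed
  have "card (r ` F) \<le> M"
  proof (rule reps)
    fix u v assume "u \<in> r ` F" "v \<in> r ` F" "u - v \<in> L"
    then obtain x y where *: "x \<in> F" "y \<in> F" "u = r x" "v = r y"
      by auto
    have "u = r u"
      unfolding *(3) by (rule r_eq[OF r(2)[OF *(1)]])
    also have "r u = r v"
      by (rule r_eq) fact
    also have "r v = v"
      unfolding *(4) by (rule r_eq[OF r(2)[OF *(2)], symmetric])
    finally show "u = v" .
  qed (use r in auto)
  have "F = (\<Union>f\<in>r ` F. {x \<in> F. x - f \<in> L})"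
    using r by auto
  then have "card F \<le> (\<Sum>f\<in>r ` F. card {x \<in> F. x - f \<in> L})"
    using card_UN_le[of "r ` F" "\<lambda>f. {x \<in> F. x - f \<in> L}"] assms(1) by simp
  also have "\<dots> \<le> (\<Sum>f\<in>r ` F. p)"
    by (intro sum_mono cls) (use r in auto)
  also have "\<dots> \<le> M * p"
    using \<open>card (r ` F) \<le> M\<close> by simp
  finally show ?thesis .
qed

text \<open>
  As long as \<open>frag_span n b\<close> is not everything, some \<open>u\<close> outside it has \<open>p u\<close> in it for a prime
  \<open>p\<close>, and \<open>u\<close> can be adjusted so that some coefficient of \<open>p u\<close> is \<open>1\<close>. Exchanging that row
  for \<open>u\<close> divides the determinant by \<open>p\<close> and merges at most \<open>p\<close> classes into one.
\<close>

lemma card_incongruent_le_det: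
  assumes "bij_betw en {..<n} E" "\<And>i. i < n \<Longrightarrow> Poly_Mapping.keys (b i) \<subseteq> E" "frag_det n en b \<noteq> 0"
    and "finite F" "\<And>x. x \<in> F \<Longrightarrow> Poly_Mapping.keys x \<subseteq> E"
    and "\<And>x y. x \<in> F \<Longrightarrow> y \<in> F \<Longrightarrow> x - y \<in> frag_span n b \<Longrightarrow> x = y"
  shows "card F \<le> nat \<bar>frag_det n en b\<bar>"
  using assms(2-)
proof (induction "nat \<bar>frag_det n en b\<bar>" arbitrary: b F rule: less_induct)
  case less
  note en = assms(1)
  let ?D = "frag_det n en b"
  show ?case
  proof (cases "\<forall>x. Poly_Mapping.keys x \<subseteq> E \<longrightarrow> x \<in> frag_span n b")
    case True
    have "x = y" if "x \<in> F" "y \<in> F" for x y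
      using less.prems(5)[OF that] True frag_span_diff less.prems(4) that by metis
    then have "card F \<le> 1"
      using card_le_Suc0_iff_eq[OF less.prems(3)] by auto
    then show ?thesis
      using less.prems(2) by linarith
  next
    case False
    then obtain x where x: "Poly_Mapping.keys x \<subseteq> E" "x \<notin> frag_span n b"
      by blast
    \<comment> \<open>By Cramer's rule the determinant annihilates the quotient by the lattice,
      hence so does its absolute value, and an element of prime order in the quotient can be
      extracted from \<open>x\<close>.\<close>
    have "frag_cmul ?D x \<in> frag_span n b"
      using frag_spanI[of "\<lambda>i. frag_det n en (b(i := x))" b n]
      by (simp only: frag_det_cramer[OF en x(1) less.prems(1)])
    then have "frag_cmul (sgn ?D) (frag_cmul ?D x) \<in> frag_span n b"
      by (rule frag_span_cmul)
    moreover have "sgn ?D * ?D = int (nat \<bar>?D\<bar>)"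
      by (simp add: sgn_if)
    ultimately have "frag_cmul (int (nat \<bar>?D\<bar>)) x \<in> frag_span n b"
      by (simp only: frag_cmul_cmul)
    then obtain p m where p: "prime p" and m: "frag_cmul (int m) x \<notin> frag_span n b"
        "frag_cmul (int p) (frag_cmul (int m) x) \<in> frag_span n b"
      using prime_order_element[of "nat \<bar>?D\<bar>" x "frag_span n b"] x(2) less.prems(2) by auto
    define u where "u = frag_cmul (int m) x"
    have u: "Poly_Mapping.keys u \<subseteq> E" "u \<notin> frag_span n b"
      using x(1) keys_cmul[of "int m" x] m by (auto simp: u_def)
    obtain c where c: "frag_cmul (int p) u = (\<Sum>i<n. frag_cmul (c i) (b i))"
      using m(2) by (auto simp: u_def frag_span_def)
    have p0: "p > 0"
      using p prime_gt_0_nat by blast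
    \<comment> \<open>If \<open>p\<close> divided every coefficient, cancelling \<open>p\<close>
      would put \<open>u\<close> itself into the lattice.\<close>
    obtain j where j: "j < n" "\<not> int p dvd c j"
    proof (rule ccontr)
      assume "\<not> thesis"
      then have dvd: "int p dvd c i" if "i < n" for i
        using \<open>\<And>j. j < n \<Longrightarrow> \<not> int p dvd c j \<Longrightarrow> thesis\<close> that by blast
      have "frag_cmul (int p) u = frag_cmul (int p) (\<Sum>i<n. frag_cmul (c i div int p) (b i))"
        unfolding c frag_cmul_sum by (intro sum.cong refl) (simp add: dvd dvd_mult_div_cancel)
      then have "u = (\<Sum>i<n. frag_cmul (c i div int p) (b i))"
        using p0 frag_cmul_left_cancel[of "int p"] by simp
      then show False
        using u(2) frag_spanI by metis
    qed
    have "coprime (int p) (c j)"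
      using prime_imp_coprime[of "int p" "c j"] p j(2) by simp
    then obtain f e where fe: "f * int p + e * c j = 1"
      using bezout_int[of "int p" "c j"] by auto
    \<comment> \<open>In \<open>p v\<close> the coefficient of \<open>b j\<close> is
      \<open>e * c j + f * p\<close>, which Bezout makes equal to 1. Hence the determinant is
      divided by exactly \<open>p\<close> when \<open>v\<close> replaces row
      \<open>j\<close>.\<close>
    define v where "v = frag_cmul e u + frag_cmul f (b j)"
    define d where "d i = (if i = j then 1 else e * c i)" for i
    have "frag_cmul (int p) v = frag_cmul e (frag_cmul (int p) u) + frag_cmul (int p * f) (b j)"
      by (simp add: v_def frag_cmul_distrib2 mult.commute)
    also have "\<dots> = (\<Sum>i<n. frag_cmul (e * c i) (b i) + (if i = j then frag_cmul (int p * f) (b i) else 0))"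
      using j(1) by (simp add: c frag_cmul_sum sum.distrib)
    also have "\<dots> = (\<Sum>i<n. frag_cmul (d i) (b i))"
      using fe by (intro sum.cong) (auto simp: d_def frag_cmul_distrib[symmetric] algebra_simps)
    finally have v: "frag_cmul (int p) v = (\<Sum>i<n. frag_cmul (d i) (b i))" .
    let ?b = "b(j := v)"
    have det: "int p * frag_det n en ?b = ?D"
      using frag_det_cmul[OF j(1), of en b "int p" v] frag_det_lincomb[OF j(1), of en b d]
      by (simp add: v d_def)
    have b': "Poly_Mapping.keys (?b i) \<subseteq> E" if "i < n" for i
    proof -
      have "Poly_Mapping.keys v \<subseteq> E"
        using keys_add[of "frag_cmul e u" "frag_cmul f (b j)"] keys_cmul[of e u] keys_cmul[of f "b j"]
          u(1) less.prems(1)[OF j(1)] unfolding v_def by blast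
      then show ?thesis
        using less.prems(1)[OF that] by simp
    qed
    have det0: "frag_det n en ?b \<noteq> 0"
      using det less.prems(2) by auto
    have smaller: "nat \<bar>frag_det n en ?b\<bar> < nat \<bar>?D\<bar>"
    proof -
      have "1 * \<bar>frag_det n en ?b\<bar> < int p * \<bar>frag_det n en ?b\<bar>"
        using det0 prime_gt_1_nat[OF p] by (intro mult_strict_right_mono) auto
      then show ?thesis
        unfolding det[symmetric] abs_mult by simp
    qed
    \<comment> \<open>Inside one class modulo the new lattice, elements of \<open>F\<close> are told
      apart by their coefficient at \<open>v\<close> modulo \<open>p\<close>: the other rows and
      \<open>p v\<close> belong to the old lattice, modulo which \<open>F\<close> is
      incongruent.\<close>
    have cls: "card {x \<in> F. x - f \<in> frag_span n ?b} \<le> p" if "f \<in> F" for f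
    proof -
      let ?K = "{x \<in> F. x - f \<in> frag_span n ?b}"
      have "\<forall>x\<in>?K. \<exists>a. x - f = (\<Sum>i<n. frag_cmul (a i) (?b i))"
        by (auto simp: frag_span_def)
      from bchoice[OF this] obtain a
        where a: "\<And>x. x \<in> ?K \<Longrightarrow> x - f = (\<Sum>i<n. frag_cmul (a x i) (?b i))"
        by blast
      have "inj_on (\<lambda>x. a x j mod int p) ?K"
      proof (rule inj_onI)
        fix x y assume x: "x \<in> ?K" and y: "y \<in> ?K" and "a x j mod int p = a y j mod int p"
        then have "int p dvd a x j - a y j"
          by (simp add: mod_eq_dvd_iff)
        then obtain t where t: "a x j - a y j = int p * t"
          by (rule dvdE)
        have "x - y = (x - f) - (y - f)"
          by simp
        also have "\<dots> = (\<Sum>i<n. frag_cmul (a x i - a y i) (?b i))"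
          unfolding a[OF x] a[OF y] by (simp add: sum_subtractf frag_cmul_diff_distrib del: fun_upd_apply)
        also have "\<dots> \<in> frag_span n b"
        proof (rule frag_span_sum)
          fix i assume i: "i \<in> {..<n}"
          show "frag_cmul (a x i - a y i) (?b i) \<in> frag_span n b"
          proof (cases "i = j")
            case True
            have "frag_cmul (a x j - a y j) v = frag_cmul t (frag_cmul (int p) v)"
              by (simp add: t mult.commute)
            then show ?thesis
              using frag_span_cmul[OF frag_spanI, of t d b n] True by (simp add: v)
          qed (use i in \<open>auto intro: frag_span_cmul frag_span_superset\<close>)
        qed
        finally show "x = y"
          using less.prems(5) x y by blast
      qed
      then have "card ?K = card ((\<lambda>x. a x j mod int p) ` ?K)"
        by (simp add: card_image)
      also have "\<dots> \<le> card {0..<int p}"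
        using p0 by (intro card_mono) auto
      finally show ?thesis
        by simp
    qed
    have "card F \<le> nat \<bar>frag_det n en ?b\<bar> * p"
    proof (rule card_le_representatives[OF less.prems(3) frag_span_0 frag_span_diff _ cls])
      fix R assume "R \<subseteq> F" "\<And>x y. x \<in> R \<Longrightarrow> y \<in> R \<Longrightarrow> x - y \<in> frag_span n ?b \<Longrightarrow> x = y"
      then show "card R \<le> nat \<bar>frag_det n en ?b\<bar>"
        using less.hyps[OF smaller b' det0, of R] less.prems(3,4) finite_subset[of R F] by blast
    qed
    also have "\<dots> = nat \<bar>?D\<bar>"
      unfolding det[symmetric] abs_mult by (simp add: nat_mult_distrib mult.commute)
    finally show ?thesis .
  qed
qed

lemma frag_det_hadamard:
  assumes en: "bij_betw en {..<n} E"
  shows "real_of_int ((frag_det n en b)\<^sup>2) \<le> (\<Prod>i<n. \<Sum>e\<in>E. (real_of_int (poly_mapping.lookup (b i) e))\<^sup>2)"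
proof -
  have "real_of_int ((frag_det n en b)\<^sup>2) = (rows_det n (\<lambda>i k. real_of_int (poly_mapping.lookup (b i) (en k))))\<^sup>2"
    by (simp add: frag_det_def rows_det_of_int)
  also have "\<dots> \<le> (\<Prod>i<n. \<Sum>k<n. (real_of_int (poly_mapping.lookup (b i) (en k)))\<^sup>2)"
    by (rule hadamard_inequality)
  also have "\<dots> = (\<Prod>i<n. \<Sum>e\<in>E. (real_of_int (poly_mapping.lookup (b i) e))\<^sup>2)"
    by (intro prod.cong refl sum.reindex_bij_betw[OF en])
  finally show ?thesis .
qed

section \<open>Torsion of the cokernel of an integer matrix\<close>

definition frag_image :: "('t \<Rightarrow> 'e \<Rightarrow>\<^sub>0 int) \<Rightarrow> 't set \<Rightarrow> ('e \<Rightarrow>\<^sub>0 int) set" where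
  "frag_image d T = frag_extend d ` {c. Poly_Mapping.keys c \<subseteq> T}"

lemma frag_image_diff: "x \<in> frag_image d T \<Longrightarrow> y \<in> frag_image d T \<Longrightarrow> x - y \<in> frag_image d T"
proof -
  assume "x \<in> frag_image d T" "y \<in> frag_image d T"
  then obtain c c' where c: "Poly_Mapping.keys c \<subseteq> T" "Poly_Mapping.keys c' \<subseteq> T"
      "x = frag_extend d c" "y = frag_extend d c'"
    by (auto simp: frag_image_def)
  then have "x - y = frag_extend d (c - c')" "Poly_Mapping.keys (c - c') \<subseteq> T"
    using keys_diff[of c c'] by (auto simp: frag_extend_diff)
  then show ?thesis
    by (auto simp: frag_image_def)
qed

lemma frag_image_0: "0 \<in> frag_image d T"
  unfolding frag_image_def by (rule image_eqI[of _ _ 0]) auto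

lemma frag_image_uminus: "x \<in> frag_image d T \<Longrightarrow> - x \<in> frag_image d T"
  using frag_image_diff[OF frag_image_0] by fastforce

lemma frag_image_add: "x \<in> frag_image d T \<Longrightarrow> y \<in> frag_image d T \<Longrightarrow> x + y \<in> frag_image d T"
  using frag_image_diff[of x d T "- y"] frag_image_uminus[of y d T] by simp

lemma frag_image_cmul: "x \<in> frag_image d T \<Longrightarrow> frag_cmul k x \<in> frag_image d T"
  by (rule frag_closure_minus_cmul) (auto intro: frag_image_0 frag_image_diff)

lemma frag_image_sum: "(\<And>i. i \<in> I \<Longrightarrow> f i \<in> frag_image d T) \<Longrightarrow> sum f I \<in> frag_image d T"
  by (induction I rule: infinite_finite_induct) (auto intro: frag_image_0 frag_image_add)

lemma frag_image_superset: "t \<in> T \<Longrightarrow> d t \<in> frag_image d T"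
  unfolding frag_image_def by (rule image_eqI[of _ _ "frag_of t"]) auto

lemma frag_image_subset:
  assumes "\<And>t. t \<in> T \<Longrightarrow> f (d t) \<in> M" "f 0 = 0" "\<And>x y. f (x - y) = f x - f y"
    and "0 \<in> M" "\<And>x y. x \<in> M \<Longrightarrow> y \<in> M \<Longrightarrow> x - y \<in> M" and "x \<in> frag_image d T"
  shows "f x \<in> M"
proof -
  obtain c where c: "Poly_Mapping.keys c \<subseteq> T" "x = frag_extend d c"
    using assms(6) by (auto simp: frag_image_def)
  show ?thesis
    unfolding c(2) using c(1) by (induction rule: frag_induction) (auto simp: assms frag_extend_diff)
qed

text \<open>
  Complete a maximal independent family of the \<open>d t\<close> by unit vectors to \<open>n\<close> rows with nonzero
  determinant. By Cramer's rule every element of \<open>frag_image d T\<close> has a multiple in the span of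
  the chosen \<open>d t\<close>, so that torsion elements incongruent modulo \<open>frag_image d T\<close> remain incongruent
  modulo the span of all the rows, and the unit rows do not contribute to Hadamard's bound.
\<close>

theorem card_torsion_frag_image_le:
  fixes d :: "'t \<Rightarrow> 'e \<Rightarrow>\<^sub>0 int" and q :: real
  assumes E: "finite E" and T: "finite T"
    and d: "\<And>t. t \<in> T \<Longrightarrow> Poly_Mapping.keys (d t) \<subseteq> E"
    and q: "\<And>t. t \<in> T \<Longrightarrow> (\<Sum>e\<in>E. (real_of_int (poly_mapping.lookup (d t) e))\<^sup>2) \<le> q" "1 \<le> q"
    and F: "finite F" "\<And>x. x \<in> F \<Longrightarrow> Poly_Mapping.keys x \<subseteq> E"
    and tors: "\<And>x. x \<in> F \<Longrightarrow> \<exists>m>0. frag_cmul (int m) x \<in> frag_image d T"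
    and incong: "\<And>x y. x \<in> F \<Longrightarrow> y \<in> F \<Longrightarrow> x - y \<in> frag_image d T \<Longrightarrow> x = y"
  shows "(real (card F))\<^sup>2 \<le> q ^ card T"
proof -
  define n where "n = card E"
  obtain en where en: "bij_betw en {..<n} E"
    using ex_bij_betw_nat_finite[OF E] by (auto simp: n_def lessThan_atLeast0)
  \<comment> \<open>The rows to choose from: \<open>Inl t\<close> stands for the generator
    \<open>d t\<close> and \<open>Inr i\<close> for a unit vector. A selection \<open>s\<close> is
    admissible if its determinant is nonzero, and \<open>I s\<close> marks the positions that hold
    generators.\<close>
  define row where "row = case_sum d (\<lambda>i::nat. frag_of (en i))"
  define ok where "ok s \<longleftrightarrow> (\<forall>i<n. s i \<in> Inl ` T \<union> Inr ` {..<n}) \<and> frag_det n en (row \<circ> s) \<noteq> 0" for s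
  define I where "I s = {i. i < n \<and> s i \<in> Inl ` T}" for s :: "nat \<Rightarrow> 't + nat"
  have card_I: "card (I s) \<le> n" for s
    using card_mono[of "{..<n}" "I s"] by (auto simp: I_def)
  have "(\<lambda>i k. poly_mapping.lookup ((row \<circ> Inr) i) (en k)) = (\<lambda>i k. if en k = en i then 1 else 0)"
    by (auto simp: row_def fun_eq_iff)
  then have "frag_det n en (row \<circ> Inr) = rows_det n (\<lambda>i k. if en k = en i then 1 else 0)"
    by (simp only: frag_det_def)
  also have "\<dots> = rows_det n (\<lambda>i k. if i = k then 1 else 0)"
    using en by (intro rows_det_cong) (auto simp: bij_betw_def inj_on_def)
  finally have "ok Inr"
    by (simp add: ok_def rows_det_unit)
  \<comment> \<open>A selection with the most generators exists because the all-unit one is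
    admissible and the number of generators is at most \<open>n\<close>.\<close>
  then obtain s where s: "ok s" and max: "\<And>s'. ok s' \<Longrightarrow> card (I s') \<le> card (I s)"
    using ex_has_greatest_nat[of ok Inr "\<lambda>s. card (I s)" "Suc n"] card_I
    by (auto simp: less_Suc_eq_le)
  define b where "b = row \<circ> s"
  let ?D = "frag_det n en b"
  have D: "?D \<noteq> 0"
    using s by (simp add: ok_def b_def)
  have b_keys: "Poly_Mapping.keys (b i) \<subseteq> E" if "i < n" for i
    using s that d bij_betw_apply[OF en] by (fastforce simp: ok_def b_def row_def)
  have unit: "\<exists>k<n. s i = Inr k" if "i < n" "i \<notin> I s" for i
    using s that by (auto simp: ok_def I_def)
  define L where "L = {\<Sum>i<n. frag_cmul (c i) (b i) | c. \<forall>i<n. i \<notin> I s \<longrightarrow> c i = 0}"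
  have L_diff: "x - y \<in> L" if xy: "x \<in> L" "y \<in> L" for x y
  proof -
    obtain c c' where "\<forall>i<n. i \<notin> I s \<longrightarrow> c i = 0" "\<forall>i<n. i \<notin> I s \<longrightarrow> c' i = 0"
        "x = (\<Sum>i<n. frag_cmul (c i) (b i))" "y = (\<Sum>i<n. frag_cmul (c' i) (b i))"
      using xy by (auto simp: L_def)
    then show ?thesis
      unfolding L_def
      by (intro CollectI exI[of _ "\<lambda>i. c i - c' i"]) (simp add: frag_cmul_diff_distrib sum_subtractf)
  qed
  have L_0: "0 \<in> L"
    unfolding L_def by (intro CollectI exI[of _ "\<lambda>_. 0"]) simp
  have L_cmul: "frag_cmul k x \<in> L" if "x \<in> L" for k x
    using that by (intro frag_closure_minus_cmul[of "\<lambda>x. x \<in> L"]) (auto intro: L_0 L_diff)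
  have L_image: "x \<in> frag_image d T" if "x \<in> L" for x
  proof -
    obtain c where c: "\<forall>i<n. i \<notin> I s \<longrightarrow> c i = 0" "x = (\<Sum>i<n. frag_cmul (c i) (b i))"
      using \<open>x \<in> L\<close> by (auto simp: L_def)
    have "frag_cmul (c i) (b i) \<in> frag_image d T" if "i < n" for i
    proof (cases "i \<in> I s")
      case True
      then show ?thesis
        by (auto simp: I_def b_def row_def intro!: frag_image_cmul frag_image_superset)
    qed (use c(1) that in \<open>simp add: frag_image_0\<close>)
    then show ?thesis
      unfolding c(2) by (intro frag_image_sum) auto
  qed
  \<comment> \<open>Putting \<open>d t\<close> in place of a unit row would add a generator, so by
    maximality the determinant becomes 0. In Cramer's formula only the selected generators therefore
    keep nonzero coefficients.\<close>
  have d_L: "frag_cmul ?D (d t) \<in> L" if t: "t \<in> T" for t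
  proof -
    have "frag_det n en (b(i := d t)) = 0" if i: "i < n" "i \<notin> I s" for i
    proof (rule ccontr)
      assume "frag_det n en (b(i := d t)) \<noteq> 0"
      moreover have "b(i := d t) = row \<circ> s(i := Inl t)"
        by (auto simp: b_def row_def)
      ultimately have "ok (s(i := Inl t))"
        using s t by (auto simp: ok_def)
      moreover have "I (s(i := Inl t)) = insert i (I s)"
        using i t by (auto simp: I_def)
      moreover have "finite (I s)"
        by (simp add: I_def)
      ultimately show False
        using max[of "s(i := Inl t)"] i(2) by simp
    qed
    then show ?thesis
      unfolding L_def by (intro CollectI exI[of _ "\<lambda>i. frag_det n en (b(i := d t))"])
        (simp add: frag_det_cramer[OF en d[OF t] b_keys])
  qed
  have image_L: "frag_cmul ?D x \<in> L" if "x \<in> frag_image d T" for x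
  proof (rule frag_image_subset[OF _ _ _ L_0 L_diff that])
    show "frag_cmul ?D (x - y) = frag_cmul ?D x - frag_cmul ?D y" for x y :: "'e \<Rightarrow>\<^sub>0 int"
      by (rule poly_mapping_eqI) (simp add: lookup_minus right_diff_distrib)
  qed (auto intro: d_L)
  have "card F \<le> nat \<bar>?D\<bar>"
  proof (rule card_incongruent_le_det[OF en b_keys D F])
    fix x y assume xy: "x \<in> F" "y \<in> F" "x - y \<in> frag_span n b"
    then obtain c where c: "x - y = (\<Sum>i<n. frag_cmul (c i) (b i))"
      by (auto simp: frag_span_def)
    obtain m m' where m: "m > 0" "frag_cmul (int m) x \<in> frag_image d T"
        "m' > 0" "frag_cmul (int m') y \<in> frag_image d T"
      using tors xy by meson
    \<comment> \<open>The factor \<open>m * m'\<close> moves \<open>x - y\<close> into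
      \<open>frag_image d T\<close>, and \<open>?D\<close> moves it on into \<open>L\<close>.
      Coordinates are unique because \<open>?D\<close> is nonzero, so \<open>c\<close> must vanish
      at all unit rows.\<close>
    define N where "N = ?D * (int m * int m')"
    have "N \<noteq> 0"
      using D m by (simp add: N_def)
    have "frag_cmul (int m') (frag_cmul (int m) x) - frag_cmul (int m) (frag_cmul (int m') y) \<in> frag_image d T"
      by (intro frag_image_diff frag_image_cmul m)
    also have "frag_cmul (int m') (frag_cmul (int m) x) - frag_cmul (int m) (frag_cmul (int m') y)
        = frag_cmul (int m * int m') (x - y)"
      by (rule poly_mapping_eqI) (simp add: lookup_minus algebra_simps)
    finally have "frag_cmul N (x - y) \<in> L"
      using image_L unfolding N_def by fastforce
    then obtain c' where c': "\<forall>i<n. i \<notin> I s \<longrightarrow> c' i = 0" "frag_cmul N (x - y) = (\<Sum>i<n. frag_cmul (c' i) (b i))"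
      by (auto simp: L_def)
    have "(\<Sum>i<n. frag_cmul (N * c i - c' i) (b i)) = frag_cmul N (x - y) - frag_cmul N (x - y)"
      by (subst c'(2)) (simp add: c frag_cmul_sum frag_cmul_diff_distrib sum_subtractf)
    then have "N * c i = c' i" if "i < n" for i
      using frag_det_independent[OF _ D that, of "\<lambda>i. N * c i - c' i"] by simp
    then have "c i = 0" if "i < n" "i \<notin> I s" for i
      using c'(1) that \<open>N \<noteq> 0\<close> by (metis mult_eq_0_iff)
    then have "x - y \<in> L"
      unfolding L_def c by blast
    then show "x = y"
      using incong xy L_image by blast
  qed
  then have "real (card F) \<le> real_of_int \<bar>?D\<bar>"
    by linarith
  then have "(real (card F))\<^sup>2 \<le> (real_of_int \<bar>?D\<bar>)\<^sup>2"
    by (intro power_mono) auto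
  also have "\<dots> = real_of_int (?D\<^sup>2)"
    by simp
  also have "\<dots> \<le> (\<Prod>i<n. \<Sum>e\<in>E. (real_of_int (poly_mapping.lookup (b i) e))\<^sup>2)"
    by (rule frag_det_hadamard[OF en])
  also have "\<dots> \<le> (\<Prod>i<n. if i \<in> I s then q else 1)"
  proof (rule prod_mono, intro conjI)
    fix i assume i: "i \<in> {..<n}"
    show "(\<Sum>e\<in>E. (real_of_int (poly_mapping.lookup (b i) e))\<^sup>2) \<le> (if i \<in> I s then q else 1)"
    proof (cases "i \<in> I s")
      case True
      then show ?thesis
        using q by (auto simp: I_def b_def row_def)
    next
      case False
      then obtain k where "k < n" "s i = Inr k"
        using unit i by auto
      then have "(\<Sum>e\<in>E. (real_of_int (poly_mapping.lookup (b i) e))\<^sup>2) = (\<Sum>e\<in>E. if e = en k then 1 else 0)"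
        by (intro sum.cong) (auto simp: b_def row_def)
      then show ?thesis
        using False E by simp
    qed
  qed (auto intro: sum_nonneg)
  also have "\<dots> = q ^ card (I s)"
    using prod.inter_restrict[of "{..<n}" "\<lambda>_. q" "I s"] by (simp add: I_def Int_def)
  also have "\<dots> \<le> q ^ card T"
  proof (rule power_increasing[OF _ q(2)])
    \<comment> \<open>A generator selected twice would give two equal rows and determinant 0. So at
      most \<open>card T\<close> rows contribute a factor \<open>q\<close>.\<close>
    have "inj_on s (I s)"
    proof (rule inj_onI, rule ccontr)
      fix i j assume "i \<in> I s" "j \<in> I s" "s i = s j" "i \<noteq> j"
      then show False
        using frag_det_equal_rows[of i n j b en] D by (auto simp: I_def b_def)
    qed
    then have "card (I s) \<le> card (Inl ` T :: ('t + nat) set)"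
      using T by (intro card_inj_on_le) (auto simp: I_def)
    then show "card (I s) \<le> card T"
      by (simp add: card_image)
  qed
  finally show ?thesis .
qed

section \<open>Torsion in the homology of a chain complex\<close>

lemma chain_boundaries_eq: "chain_boundaries C d n = frag_image (d (Suc n)) (C (Suc n))"
  by (auto simp: chain_boundaries_def frag_image_def)

text \<open>One chain is taken from each torsion class, which turns statements on cosets into
  statements on chains modulo \<open>B\<close>, the form in which the lattice bound is
  stated.\<close>

lemma torsion_representatives:
  assumes "finite (torsion_elements (chain_homology C d n))"
  defines "B \<equiv> frag_image (d (Suc n)) (C (Suc n))"
  obtains F where "finite F" "card F = card (torsion_elements (chain_homology C d n))"
    "\<And>x. x \<in> F \<Longrightarrow> Poly_Mapping.keys x \<subseteq> C n" "\<And>x. x \<in> F \<Longrightarrow> \<exists>m>0. frag_cmul (int m) x \<in> B"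
    "\<And>x y. x \<in> F \<Longrightarrow> y \<in> F \<Longrightarrow> x - y \<in> B \<Longrightarrow> x = y"
proof -
  let ?H = "chain_homology C d n"
  let ?Z = "subgroup_generated (free_Abelian_group (C n)) (chain_cycles C d n)"
  define cs where "cs x = {b + x | b. b \<in> B}" for x
  have H: "?H = ?Z Mod B"
    by (simp add: chain_homology_def chain_boundaries_eq B_def)
  have one: "\<one>\<^bsub>?H\<^esub> = B"
    by (simp add: H FactGroup_def)
  have carrier: "\<exists>x. Poly_Mapping.keys x \<subseteq> C n \<and> X = cs x" if X: "X \<in> carrier ?H" for X
  proof -
    obtain x where "x \<in> carrier ?Z" "X = B #>\<^bsub>?Z\<^esub> x"
      using X by (auto simp: H FactGroup_def RCOSETS_def)
    moreover from this have "x \<in> carrier (free_Abelian_group (C n))"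
      using group.carrier_subgroup_generated_subset[OF group_free_Abelian_group] by blast
    ultimately show ?thesis
      by (intro exI[of _ x]) (auto simp: r_coset_def cs_def)
  qed
  have B: "0 \<in> B" "\<And>x y. x \<in> B \<Longrightarrow> y \<in> B \<Longrightarrow> x + y \<in> B" "\<And>x y. x \<in> B \<Longrightarrow> y \<in> B \<Longrightarrow> x - y \<in> B"
    by (auto simp: B_def frag_image_0 frag_image_add frag_image_diff)
  have pow: "cs x [^]\<^bsub>?H\<^esub> m = cs (frag_cmul (int m) x)" for x and m :: nat
  proof (induction m)
    case 0
    then show ?case
      by (simp add: nat_pow_def one cs_def)
  next
    case (Suc m)
    have "cs x [^]\<^bsub>?H\<^esub> Suc m = cs (frag_cmul (int m) x) \<otimes>\<^bsub>?H\<^esub> cs x"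
      using Suc by (simp add: nat_pow_def)
    also have "\<dots> = {u + v | u v. u \<in> cs (frag_cmul (int m) x) \<and> v \<in> cs x}"
      by (auto simp: H FactGroup_def set_mult_def)
    also have "\<dots> = cs (frag_cmul (int (Suc m)) x)"
    proof safe
      fix u v assume "u \<in> cs (frag_cmul (int m) x)" "v \<in> cs x"
      then obtain b b' where "b \<in> B" "b' \<in> B" "u = b + frag_cmul (int m) x" "v = b' + x"
        by (auto simp: cs_def)
      then have "u + v = (b + b') + frag_cmul (int (Suc m)) x" "b + b' \<in> B"
        using B by (auto simp: frag_cmul_distrib algebra_simps)
      then show "u + v \<in> cs (frag_cmul (int (Suc m)) x)"
        by (auto simp: cs_def)
    next
      fix w assume "w \<in> cs (frag_cmul (int (Suc m)) x)"
      then obtain b where "b \<in> B" "w = (b + frag_cmul (int m) x) + (0 + x)"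
        by (auto simp: cs_def frag_cmul_distrib algebra_simps)
      then show "\<exists>u v. w = u + v \<and> u \<in> cs (frag_cmul (int m) x) \<and> v \<in> cs x"
        using B(1) unfolding cs_def by blast
    qed
    finally show ?case .
  qed
  have cs_eq: "cs x = cs y" if "x - y \<in> B" for x y
  proof -
    have "b + x = (b + (x - y)) + y" "b + y = (b - (x - y)) + x" for b
      by simp_all
    then show ?thesis
      unfolding cs_def using B(2)[OF _ that] B(3)[OF _ that] by blast
  qed
  let ?T = "torsion_elements ?H"
  have "\<forall>X\<in>?T. \<exists>x. Poly_Mapping.keys x \<subseteq> C n \<and> X = cs x"
    using carrier by (auto simp: torsion_elements_def)
  from bchoice[OF this] obtain r
    where r: "\<And>X. X \<in> ?T \<Longrightarrow> Poly_Mapping.keys (r X) \<subseteq> C n" "\<And>X. X \<in> ?T \<Longrightarrow> X = cs (r X)"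
    by blast
  have inj: "inj_on r ?T"
    using r(2) by (metis inj_onI)
  show thesis
  proof
    show "finite (r ` ?T)"
      using assms(1) by simp
    show "card (r ` ?T) = card ?T"
      by (rule card_image[OF inj])
    show "Poly_Mapping.keys x \<subseteq> C n" if "x \<in> r ` ?T" for x
      using that r(1) by auto
    show "\<exists>m>0. frag_cmul (int m) x \<in> B" if x: "x \<in> r ` ?T" for x
    proof -
      obtain X where X: "X \<in> ?T" "x = r X"
        using x by auto
      then obtain m :: nat where "m > 0" "X [^]\<^bsub>?H\<^esub> m = B"
        by (auto simp: torsion_elements_def one)
      then have "cs (frag_cmul (int m) x) = B"
        using pow[of x m] r(2)[OF X(1)] X(2) by simp
      moreover have "0 + frag_cmul (int m) x \<in> cs (frag_cmul (int m) x)"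
        using B(1) unfolding cs_def by blast
      ultimately show ?thesis
        using \<open>m > 0\<close> by auto
    qed
    show "x = y" if "x \<in> r ` ?T" "y \<in> r ` ?T" "x - y \<in> B" for x y
      using that r(2) cs_eq[OF that(3)] by (metis imageE)
  qed
qed

section \<open>Torsion in the first homology of a complex, and transfer of the bound\<close>

lemma complex_face:
  "finite_simplicial_complex X \<Longrightarrow> \<sigma> \<in> X \<Longrightarrow> \<tau> \<noteq> {} \<Longrightarrow> \<tau> \<subseteq> \<sigma> \<Longrightarrow> \<tau> \<in> X"
  unfolding finite_simplicial_complex_def by blast

lemma facet_in_complex_simplices:
  assumes "finite_simplicial_complex X" "\<sigma> \<in> complex_simplices X (Suc n)" "v \<in> \<sigma>"
  shows "\<sigma> - {v} \<in> complex_simplices X n"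
proof -
  have \<sigma>: "\<sigma> \<in> X" "card \<sigma> = n + 2"
    using assms(2) by (auto simp: complex_simplices_def)
  then have "card (\<sigma> - {v}) = n + 1"
    using assms(3) by simp
  moreover from this have "\<sigma> - {v} \<noteq> {}"
    by (intro notI) simp
  ultimately show ?thesis
    using complex_face[OF assms(1) \<sigma>(1), of "\<sigma> - {v}"] by (auto simp: complex_simplices_def)
qed

lemma keys_simplicial_boundary:
  assumes X: "finite_simplicial_complex X" and \<sigma>: "\<sigma> \<in> complex_simplices X (Suc n)"
  shows "Poly_Mapping.keys (simplicial_boundary (Suc n) \<sigma>) \<subseteq> complex_simplices X n"
proof -
  have "Poly_Mapping.keys (simplicial_boundary (Suc n) \<sigma>)
      \<subseteq> (\<Union>v\<in>\<sigma>. Poly_Mapping.keys (frag_cmul ((-1) ^ card {u \<in> \<sigma>. u < v}) (frag_of (\<sigma> - {v}))))"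
    unfolding simplicial_boundary_def by (simp only: nat.distinct if_False keys_sum)
  also have "\<dots> \<subseteq> (\<Union>v\<in>\<sigma>. {\<sigma> - {v}})"
    by (intro UN_mono order.refl order.trans[OF keys_cmul]) simp
  also have "\<dots> \<subseteq> complex_simplices X n"
    using facet_in_complex_simplices[OF X \<sigma>] by auto
  finally show ?thesis .
qed

text \<open>The facets are distinct and each has coefficient 1 or -1. For triangles the value is 3,
  which becomes the base of the logarithm.\<close>

lemma sum_squares_simplicial_boundary:
  assumes \<sigma>: "finite \<sigma>" "card \<sigma> = Suc n" "n > 0" and E: "finite E" "\<And>v. v \<in> \<sigma> \<Longrightarrow> \<sigma> - {v} \<in> E"
  shows "(\<Sum>e\<in>E. (real_of_int (poly_mapping.lookup (simplicial_boundary n \<sigma>) e))\<^sup>2) = Suc n"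
proof -
  let ?c = "\<lambda>v. (-1) ^ card {u \<in> \<sigma>. u < v} :: int"
  let ?l = "poly_mapping.lookup (simplicial_boundary n \<sigma>)"
  have l: "?l e = (\<Sum>v\<in>\<sigma>. if e = \<sigma> - {v} then ?c v else 0)" for e
    using \<sigma>(3) unfolding simplicial_boundary_def by (auto simp: lookup_sum intro!: sum.cong)
  have inj: "inj_on (\<lambda>v. \<sigma> - {v}) \<sigma>"
    by (auto simp: inj_on_def)
  have l_facet: "?l (\<sigma> - {w}) = ?c w" if "w \<in> \<sigma>" for w
  proof -
    have "?l (\<sigma> - {w}) = (\<Sum>v\<in>\<sigma>. if v = w then ?c w else 0)"
      unfolding l using that inj by (intro sum.cong) (auto simp: inj_on_def)
    then show ?thesis
      using \<sigma>(1) that by simp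
  qed
  have "(\<Sum>e\<in>E. (real_of_int (?l e))\<^sup>2) = (\<Sum>e\<in>(\<lambda>v. \<sigma> - {v}) ` \<sigma>. (real_of_int (?l e))\<^sup>2)"
  proof (rule sum.mono_neutral_right)
    show "\<forall>e\<in>E - (\<lambda>v. \<sigma> - {v}) ` \<sigma>. (real_of_int (?l e))\<^sup>2 = 0"
      by (auto simp: l intro!: sum.neutral)
  qed (use E in auto)
  also have "\<dots> = (\<Sum>w\<in>\<sigma>. (real_of_int (?l (\<sigma> - {w})))\<^sup>2)"
    by (simp add: sum.reindex[OF inj])
  also have "\<dots> = (\<Sum>w\<in>\<sigma>. 1)"
  proof (rule sum.cong)
    fix w assume "w \<in> \<sigma>"
    then show "(real_of_int (?l (\<sigma> - {w})))\<^sup>2 = 1"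
      by (simp add: l_facet flip: power_mult)
  qed simp
  finally show ?thesis
    using \<sigma>(2) by simp
qed

lemma card_torsion_simplicial_le:
  fixes X :: "'v::linorder set set"
  assumes X: "finite_simplicial_complex X"
    and F: "finite F" "\<And>x. x \<in> F \<Longrightarrow> Poly_Mapping.keys x \<subseteq> complex_simplices X 1"
    and tors: "\<And>x. x \<in> F \<Longrightarrow> \<exists>m>0. frag_cmul (int m) x \<in> frag_image (simplicial_boundary 2) (complex_simplices X 2)"
    and incong: "\<And>x y. x \<in> F \<Longrightarrow> y \<in> F \<Longrightarrow>
      x - y \<in> frag_image (simplicial_boundary 2) (complex_simplices X 2) \<Longrightarrow> x = y"
  shows "(real (card F))\<^sup>2 \<le> 3 ^ card (complex_simplices X 2)"
proof (rule card_torsion_frag_image_le[OF _ _ _ _ _ F tors incong])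
  show fin: "finite (complex_simplices X 1)" "finite (complex_simplices X 2)"
    using X by (auto simp: finite_simplicial_complex_def complex_simplices_def)
  fix \<sigma> assume \<sigma>: "\<sigma> \<in> complex_simplices X 2"
  show "Poly_Mapping.keys (simplicial_boundary 2 \<sigma>) \<subseteq> complex_simplices X 1"
    using keys_simplicial_boundary[OF X, of \<sigma> 1] \<sigma> by (simp add: numeral_2_eq_2)
  have "\<sigma> \<in> X" "card \<sigma> = 3"
    using \<sigma> by (auto simp: complex_simplices_def)
  moreover have "\<sigma> - {v} \<in> complex_simplices X 1" if "v \<in> \<sigma>" for v
    using facet_in_complex_simplices[OF X _ that, of 1] \<sigma> by (simp add: numeral_2_eq_2)
  ultimately show "(\<Sum>e\<in>complex_simplices X 1. (real_of_int (poly_mapping.lookup (simplicial_boundary 2 \<sigma>) e))\<^sup>2) \<le> 3"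
    using sum_squares_simplicial_boundary[of \<sigma> 2 "complex_simplices X 1"] fin(1)
    by (simp add: card_ge_0_finite)
qed auto

lemma two_log_le:
  assumes "(real k)\<^sup>2 \<le> 3 ^ n"
  shows "2 * log 3 (real k) \<le> real n"
proof (cases "k = 0")
  \<comment> \<open>The value of \<open>log 3 0\<close> is 0, so the claim is trivial in this
    case.\<close>
  case True
  then show ?thesis
    by (simp add: log_def)
next
  case False
  then have "2 * log 3 (real k) = log 3 ((real k)\<^sup>2)"
    by (simp add: log_nat_power)
  also have "\<dots> \<le> log 3 (3 ^ n)"
    using assms False by (subst log_le_cancel_iff) auto
  also have "\<dots> = real n"
    by (simp add: log_nat_power)
  finally show ?thesis .
qed

text \<open>An infinite torsion group has cardinality \<open>0\<close> here.\<close>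

lemma two_log_torsion_le:
  assumes "\<And>F. finite F \<Longrightarrow> (\<And>x. x \<in> F \<Longrightarrow> Poly_Mapping.keys x \<subseteq> C n) \<Longrightarrow>
      (\<And>x. x \<in> F \<Longrightarrow> \<exists>m>0. frag_cmul (int m) x \<in> frag_image (d (Suc n)) (C (Suc n))) \<Longrightarrow>
      (\<And>x y. x \<in> F \<Longrightarrow> y \<in> F \<Longrightarrow> x - y \<in> frag_image (d (Suc n)) (C (Suc n)) \<Longrightarrow> x = y) \<Longrightarrow>
      (real (card F))\<^sup>2 \<le> 3 ^ k"
  shows "2 * log 3 (real (card (torsion_elements (chain_homology C d n)))) \<le> real k"
proof (cases "finite (torsion_elements (chain_homology C d n))")
  case True
  then show ?thesis
  proof (rule torsion_representatives)
    fix F assume F: "finite F" "card F = card (torsion_elements (chain_homology C d n))"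
      "\<And>x. x \<in> F \<Longrightarrow> Poly_Mapping.keys x \<subseteq> C n"
      "\<And>x. x \<in> F \<Longrightarrow> \<exists>m>0. frag_cmul (int m) x \<in> frag_image (d (Suc n)) (C (Suc n))"
      "\<And>x y. x \<in> F \<Longrightarrow> y \<in> F \<Longrightarrow> x - y \<in> frag_image (d (Suc n)) (C (Suc n)) \<Longrightarrow> x = y"
    show "2 * log 3 (real (card (torsion_elements (chain_homology C d n)))) \<le> real k"
      unfolding F(2)[symmetric] by (rule two_log_le, rule assms) (fact F)+
  qed
next
  case False
  then show ?thesis
    by (simp add: log_def)
qed

theorem two_log_torsion_simplicial_homology_le:
  fixes X :: "'v::linorder set set"
  assumes "finite_simplicial_complex X"
  shows "2 * log 3 (real (card (torsion_elements (simplicial_homology 1 X)))) \<le> real (card (complex_simplices X 2))"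
  unfolding simplicial_homology_def
  by (rule two_log_torsion_le) (rule card_torsion_simplicial_le[OF assms], simp_all add: numeral_2_eq_2)

text \<open>Up to boundaries \<open>\<psi>\<close> undoes \<open>\<phi>\<close>, so
  \<open>\<phi>\<close> keeps incongruent chains incongruent. It preserves torsion because it sends
  boundaries to boundaries. The images are chains of edges of \<open>X\<close>, to which the count
  applies.\<close>

theorem two_log_torsion_retract_le:
  fixes X :: "'v::linorder set set"
  assumes X: "finite_simplicial_complex X"
  defines "B \<equiv> frag_image (simplicial_boundary 2) (complex_simplices X 2)"
  assumes \<phi>: "\<And>g. g \<in> C n \<Longrightarrow> Poly_Mapping.keys (\<phi> g) \<subseteq> complex_simplices X 1"
    and \<phi>_B: "\<And>t. t \<in> C (Suc n) \<Longrightarrow> frag_extend \<phi> (d (Suc n) t) \<in> B"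
    and \<psi>_B: "\<And>\<sigma>. \<sigma> \<in> complex_simplices X 2 \<Longrightarrow>
      frag_extend \<psi> (simplicial_boundary 2 \<sigma>) \<in> frag_image (d (Suc n)) (C (Suc n))"
    and retract: "\<And>g. g \<in> C n \<Longrightarrow> frag_extend \<psi> (\<phi> g) - frag_of g \<in> frag_image (d (Suc n)) (C (Suc n))"
  shows "2 * log 3 (real (card (torsion_elements (chain_homology C d n)))) \<le> real (card (complex_simplices X 2))"
proof (rule two_log_torsion_le)
  let ?B = "frag_image (d (Suc n)) (C (Suc n))"
  let ?\<Phi> = "frag_extend \<phi>" and ?\<Psi> = "frag_extend \<psi>"
  fix F
  assume F: "finite F" "\<And>x. x \<in> F \<Longrightarrow> Poly_Mapping.keys x \<subseteq> C n"
    and tors: "\<And>x. x \<in> F \<Longrightarrow> \<exists>m>0. frag_cmul (int m) x \<in> ?B"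
    and incong: "\<And>x y. x \<in> F \<Longrightarrow> y \<in> F \<Longrightarrow> x - y \<in> ?B \<Longrightarrow> x = y"
  have \<Phi>_B: "?\<Phi> x \<in> B" if "x \<in> ?B" for x
    by (rule frag_image_subset[where f = ?\<Phi> and M = B, OF \<phi>_B _ _ _ _ that])
      (auto simp: frag_extend_diff B_def frag_image_0 frag_image_diff)
  have \<Psi>_B: "?\<Psi> x \<in> ?B" if "x \<in> B" for x
    by (rule frag_image_subset[where f = ?\<Psi> and M = ?B, OF \<psi>_B _ _ _ _ that[unfolded B_def]])
      (auto simp: frag_extend_diff frag_image_0 frag_image_diff)
  have retr: "?\<Psi> (?\<Phi> x) - x \<in> ?B" if "Poly_Mapping.keys x \<subseteq> C n" for x
    using that
  proof (induction rule: frag_induction)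
    case (diff a b)
    have "?\<Psi> (?\<Phi> (a - b)) - (a - b) = (?\<Psi> (?\<Phi> a) - a) - (?\<Psi> (?\<Phi> b) - b)"
      by (simp add: frag_extend_diff)
    then show ?case
      using diff frag_image_diff by metis
  qed (auto simp: frag_image_0 retract)
  have inj: "x = y" if "x \<in> F" "y \<in> F" "?\<Phi> x - ?\<Phi> y \<in> B" for x y
  proof (rule incong[OF that(1,2)])
    have "x - y = ?\<Psi> (?\<Phi> x - ?\<Phi> y) - (?\<Psi> (?\<Phi> x) - x) + (?\<Psi> (?\<Phi> y) - y)"
      by (simp add: frag_extend_diff)
    also have "\<dots> \<in> ?B"
      by (intro frag_image_add frag_image_diff \<Psi>_B retr F that)
    finally show "x - y \<in> ?B" .
  qed
  have "inj_on ?\<Phi> F"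
    by (rule inj_onI, rule inj) (auto simp: B_def frag_image_0)
  then have "card (?\<Phi> ` F) = card F"
    by (rule card_image)
  moreover have "(real (card (?\<Phi> ` F)))\<^sup>2 \<le> 3 ^ card (complex_simplices X 2)"
  proof (rule card_torsion_simplicial_le[OF X])
    fix y assume "y \<in> ?\<Phi> ` F"
    then obtain x where x: "x \<in> F" "y = ?\<Phi> x"
      by blast
    show "Poly_Mapping.keys y \<subseteq> complex_simplices X 1"
      using keys_frag_extend[of \<phi> x] F(2)[OF x(1)] \<phi> unfolding x(2) by blast
    obtain m where "m > 0" "frag_cmul (int m) x \<in> ?B"
      using tors[OF x(1)] by blast
    then show "\<exists>m>0. frag_cmul (int m) y \<in> frag_image (simplicial_boundary 2) (complex_simplices X 2)"
      using \<Phi>_B[of "frag_cmul (int m) x"] unfolding x(2) by (auto simp: frag_extend_cmul B_def)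
  next
    fix y y' assume "y \<in> ?\<Phi> ` F" "y' \<in> ?\<Phi> ` F"
      "y - y' \<in> frag_image (simplicial_boundary 2) (complex_simplices X 2)"
    then show "y = y'"
      using inj unfolding B_def by blast
  qed (use F in simp)
  ultimately show "(real (card F))\<^sup>2 \<le> 3 ^ card (complex_simplices X 2)"
    by simp
qed

section \<open>The covering defined by the cocycle of edges\<close>

locale realized_complex =
  fixes X :: "'v::linorder set set"
  assumes X: "finite_simplicial_complex X"
begin

abbreviation "S \<equiv> complex_realization X"
abbreviation "E \<equiv> complex_simplices X 1"
abbreviation "B \<equiv> frag_image (simplicial_boundary 2) (complex_simplices X 2)"

text \<open>Antisymmetric and 0 on the diagonal, so that the cocycle relation can be stated for
  vertices in any order and with repetitions.\<close>

definition edge :: "'v \<Rightarrow> 'v \<Rightarrow> 'v set \<Rightarrow>\<^sub>0 int" where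
  "edge u v = (if u < v then frag_of {u, v} else if v < u then - frag_of {u, v} else 0)"

lemma keys_edge: "{u, v} \<in> X \<Longrightarrow> Poly_Mapping.keys (edge u v) \<subseteq> E"
  by (auto simp: edge_def complex_simplices_def)

lemma edge_refl [simp]: "edge u u = 0"
  by (simp add: edge_def)

lemma edge_swap: "edge v u = - edge u v"
  by (auto simp: edge_def insert_commute)

lemma simplicial_boundary_triangle:
  assumes "a < b" "b < c"
  shows "simplicial_boundary 2 {a, b, c} = edge b c - edge a c + edge a b"
proof -
  define \<sigma> where "\<sigma> = {a, b, c}"
  have ne: "a < c" "a \<noteq> b" "b \<noteq> c" "a \<noteq> c"
    using assms by auto
  have below: "{u \<in> \<sigma>. u < a} = {}" "{u \<in> \<sigma>. u < b} = {a}" "{u \<in> \<sigma>. u < c} = {a, b}"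
    using assms by (auto simp: \<sigma>_def)
  have card: "card {u \<in> \<sigma>. u < a} = 0" "card {u \<in> \<sigma>. u < b} = 1" "card {u \<in> \<sigma>. u < c} = 2"
    using ne by (simp_all add: below)
  have diff: "\<sigma> - {a} = {b, c}" "\<sigma> - {b} = {a, c}" "\<sigma> - {c} = {a, b}"
    using ne by (auto simp: \<sigma>_def)
  have "(\<Sum>v\<in>\<sigma>. g v) = g a + g b + g c" for g :: "'v \<Rightarrow> 'v set \<Rightarrow>\<^sub>0 int"
    using ne by (simp add: \<sigma>_def algebra_simps)
  then have "simplicial_boundary 2 \<sigma> = frag_of {b, c} - frag_of {a, c} + frag_of {a, b}"
    by (simp add: simplicial_boundary_def card diff)
  then show ?thesis
    using assms ne by (simp add: edge_def \<sigma>_def)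
qed

text \<open>Up to sign the sum is the boundary of the triangle, or it is 0 when two vertices
  coincide. The nine cases are the three coincidences and the six orders.\<close>

lemma edge_cocycle:
  assumes "{u, v, w} \<in> X"
  shows "edge u v + edge v w - edge u w \<in> B"
proof -
  have ordered: "edge b c - edge a c + edge a b \<in> B" if "a < b" "b < c" "{a, b, c} = {u, v, w}" for a b c
  proof -
    have "a \<noteq> b" "b \<noteq> c" "a \<noteq> c"
      using that(1,2) by auto
    then have "card {a, b, c} = 3"
      by simp
    moreover have "{a, b, c} \<in> X"
      unfolding that(3) by (rule assms)
    ultimately have "{a, b, c} \<in> complex_simplices X 2"
      by (simp add: complex_simplices_def)
    then show ?thesis
      using frag_image_superset[of "{a, b, c}" _ "simplicial_boundary 2"] simplicial_boundary_triangle[OF that(1,2)]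
      by metis
  qed
  consider "u = v" | "v = w" | "u = w" | "u < v" "v < w" | "u < w" "w < v" | "v < u" "u < w"
    | "v < w" "w < u" | "w < u" "u < v" | "w < v" "v < u"
    by (meson linorder_less_linear)
  then show ?thesis
  proof cases
    case 1 then show ?thesis by (simp add: frag_image_0)
  next
    case 2 then show ?thesis by (simp add: frag_image_0)
  next
    case 3 then show ?thesis using edge_swap[of u v] by (simp add: frag_image_0)
  next
    case 4 then show ?thesis using ordered[of u v w] by (simp add: algebra_simps)
  next
    case 5
    then show ?thesis
      using frag_image_uminus[OF ordered[of u w v]] edge_swap[of w v] by (auto simp: algebra_simps insert_commute)
  next
    case 6
    then show ?thesis
      using frag_image_uminus[OF ordered[of v u w]] edge_swap[of v u] by (auto simp: algebra_simps insert_commute)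
  next
    case 7
    then show ?thesis
      using ordered[of v w u] edge_swap[of u v] edge_swap[of u w] by (auto simp: algebra_simps insert_commute)
  next
    case 8
    then show ?thesis
      using ordered[of w u v] edge_swap[of v w] edge_swap[of u w] by (auto simp: algebra_simps insert_commute)
  next
    case 9
    then show ?thesis
      using frag_image_uminus[OF ordered[of w v u]] edge_swap[of v u] edge_swap[of v w] edge_swap[of u w]
      by (auto simp: algebra_simps insert_commute)
  qed
qed

lemma realization_nonneg: "x \<in> S \<Longrightarrow> 0 \<le> x v"
  by (simp add: complex_realization_def)

lemma support_simplex: "x \<in> S \<Longrightarrow> {v. x v \<noteq> 0} \<in> X"
  by (simp add: complex_realization_def)

lemma positive_simplex:
  assumes "x \<in> S" "A \<noteq> {}" "\<And>v. v \<in> A \<Longrightarrow> 0 < x v"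
  shows "A \<in> X"
  by (rule complex_face[OF X support_simplex[OF assms(1)] assms(2)]) (use assms(3) in fastforce)

text \<open>Selects one open star containing \<open>x\<close>. The selection is not continuous in
  general; its jumps are what the edges in a lift compensate.\<close>

definition vert :: "('v \<Rightarrow> real) \<Rightarrow> 'v" where
  "vert x = (SOME v. 0 < x v)"

lemma vert_pos: "x \<in> S \<Longrightarrow> 0 < x (vert x)"
proof -
  assume x: "x \<in> S"
  then have "{v. x v \<noteq> 0} \<noteq> {}"
    using support_simplex X unfolding finite_simplicial_complex_def by blast
  then obtain v where "0 < x v"
    using realization_nonneg[OF x] by (fastforce simp: less_le)
  then show ?thesis
    unfolding vert_def by (rule someI)
qed

text \<open>
  The edges form a 1-cocycle with values in \<open>\<int>[E] / B\<close> on the cover of the realization by open stars.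
  A lift of \<open>f\<close> is a section of the corresponding covering along \<open>f\<close>.
\<close>

definition lifts :: "'a::topological_space set \<Rightarrow> ('a \<Rightarrow> 'v \<Rightarrow> real) \<Rightarrow> ('a \<Rightarrow> 'v set \<Rightarrow>\<^sub>0 int) \<Rightarrow> bool" where
  "lifts T f h \<longleftrightarrow> (\<forall>t\<in>T. Poly_Mapping.keys (h t) \<subseteq> E) \<and>
     (\<forall>t\<in>T. \<exists>U. open U \<and> t \<in> U \<and> (\<forall>s\<in>T \<inter> U. h s - h t - edge (vert (f t)) (vert (f s)) \<in> B))"

lemma lifts_near:
  "lifts T f h \<Longrightarrow> t \<in> T \<Longrightarrow>
    \<exists>U. open U \<and> t \<in> U \<and> (\<forall>s\<in>T \<inter> U. h s - h t - edge (vert (f t)) (vert (f s)) \<in> B)"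
  by (simp add: lifts_def)

lemma liftsE:
  assumes "lifts T f h" "t \<in> T"
  obtains U where "open U" "t \<in> U" "\<forall>s\<in>T \<inter> U. h s - h t - edge (vert (f t)) (vert (f s)) \<in> B"
  using lifts_near[OF assms] by (auto simp only:)

lemma lifts_keys: "lifts T f h \<Longrightarrow> t \<in> T \<Longrightarrow> Poly_Mapping.keys (h t) \<subseteq> E"
  by (simp add: lifts_def)

lemma lifts_cong:
  assumes "lifts T f h" "\<And>t. t \<in> T \<Longrightarrow> f t = f' t"
  shows "lifts T f' h"
  using assms unfolding lifts_def by (metis IntD1)

lemma lifts_compose:
  assumes "lifts T f h" "continuous_on T' g" "g ` T' \<subseteq> T"
  shows "lifts T' (f \<circ> g) (h \<circ> g)"
  unfolding lifts_def
proof (intro conjI ballI)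
  fix t assume t: "t \<in> T'"
  then show "Poly_Mapping.keys ((h \<circ> g) t) \<subseteq> E"
    using lifts_keys[OF assms(1)] assms(3) by auto
  have gt: "g t \<in> T"
    using t assms(3) by auto
  obtain U where U: "open U" "g t \<in> U" "\<forall>s\<in>T \<inter> U. h s - h (g t) - edge (vert (f (g t))) (vert (f s)) \<in> B"
    by (rule liftsE[OF assms(1) gt])
  obtain A where A: "open A" "A \<inter> T' = g -` U \<inter> T'"
    using assms(2)[unfolded continuous_on_open_invariant, rule_format, OF U(1)] by blast
  have "h (g s) - h (g t) - edge (vert (f (g t))) (vert (f (g s))) \<in> B" if "s \<in> T' \<inter> A" for s
    by (rule bspec[OF U(3)]) (use that A(2) assms(3) in auto)
  moreover have "t \<in> A"
    using A(2) U(2) t by auto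
  ultimately show "\<exists>U. open U \<and> t \<in> U \<and>
      (\<forall>s\<in>T' \<inter> U. (h \<circ> g) s - (h \<circ> g) t - edge (vert ((f \<circ> g) t)) (vert ((f \<circ> g) s)) \<in> B)"
    using A(1) by (intro exI[of _ A]) simp
qed

lemma lifts_const: "lifts T (\<lambda>_. x) (\<lambda>_. 0)"
  unfolding lifts_def by (auto simp: frag_image_0)

text \<open>Near each point both lifts change by the same edge modulo \<open>B\<close>, so their
  difference is locally constant modulo \<open>B\<close>.\<close>

lemma lifts_unique:
  assumes "connected T" "lifts T f h" "lifts T f h'" "s \<in> T" "t \<in> T"
  shows "(h s - h' s) - (h t - h' t) \<in> B"
proof -
  let ?R = "\<lambda>s t. (h s - h' s) - (h t - h' t) \<in> B"
  show "?R s t"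
  proof (rule connected_equivalence_relation[OF assms(1,4,5), where R = ?R])
    show "?R y x" if "?R x y" for x y
      using frag_image_uminus[OF that] by (simp add: algebra_simps)
    show "?R x z" if "?R x y" "?R y z" for x y z
      using frag_image_add[OF that] by (simp add: algebra_simps)
    fix x assume x: "x \<in> T"
    obtain U where U: "open U" "x \<in> U" "\<forall>s\<in>T \<inter> U. h s - h x - edge (vert (f x)) (vert (f s)) \<in> B"
      by (rule liftsE[OF assms(2) x])
    obtain U' where U': "open U'" "x \<in> U'" "\<forall>s\<in>T \<inter> U'. h' s - h' x - edge (vert (f x)) (vert (f s)) \<in> B"
      by (rule liftsE[OF assms(3) x])
    have "?R x y" if "y \<in> T \<inter> (U \<inter> U')" for y
    proof -
      have "?R x y = ((h' y - h' x - edge (vert (f x)) (vert (f y)))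
          - (h y - h x - edge (vert (f x)) (vert (f y))) \<in> B)"
        by (simp add: algebra_simps)
      then show ?thesis
        using frag_image_diff U(3) U'(3) that by blast
    qed
    then show "\<exists>A. openin (top_of_set T) A \<and> x \<in> A \<and> (\<forall>y\<in>A. ?R x y)"
      using U U' x by (intro exI[of _ "T \<inter> (U \<inter> U')"]) auto
  qed
qed

text \<open>The covering is trivial over an open star. Near \<open>t\<close>, the vertices
  \<open>v\<close>, \<open>vert (f t)\<close> and \<open>vert (f s)\<close> all have positive weight
  in \<open>f s\<close>, so they span a simplex and the cocycle relation applies.\<close>

lemma lifts_star:
  assumes f: "continuous_on T f" "f ` T \<subseteq> S" "\<And>t. t \<in> T \<Longrightarrow> 0 < f t v"
  shows "lifts T f (\<lambda>t. edge v (vert (f t)))"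
  unfolding lifts_def
proof (intro conjI ballI)
  fix t assume t: "t \<in> T"
  have fS: "f s \<in> S" if "s \<in> T" for s
    using that f(2) by auto
  have "{v, vert (f t)} \<in> X"
    by (rule positive_simplex[OF fS[OF t]]) (use f(3)[OF t] vert_pos[OF fS[OF t]] in auto)
  then show "Poly_Mapping.keys (edge v (vert (f t))) \<subseteq> E"
    by (rule keys_edge)
  define w where "w = vert (f t)"
  have "continuous_on T (\<lambda>s. f s w)"
    using f(1) by (rule continuous_on_product_then_coordinatewise)
  then obtain A where A: "open A" "A \<inter> T = (\<lambda>s. f s w) -` {0<..} \<inter> T"
    unfolding continuous_on_open_invariant by (metis open_greaterThan)
  have "t \<in> A"
    using A(2) t vert_pos[OF fS[OF t]] by (auto simp: w_def)
  moreover have "edge v (vert (f s)) - edge v w - edge w (vert (f s)) \<in> B" if "s \<in> T \<inter> A" for s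
  proof -
    have "s \<in> T" "0 < f s w"
      using that A(2) by auto
    then have "{v, w, vert (f s)} \<in> X"
      by (intro positive_simplex[OF fS]) (use f(3) vert_pos fS in auto)
    then show ?thesis
      using frag_image_uminus[OF edge_cocycle] by (simp add: algebra_simps)
  qed
  ultimately show "\<exists>U. open U \<and> t \<in> U \<and>
      (\<forall>s\<in>T \<inter> U. edge v (vert (f s)) - edge v (vert (f t)) - edge (vert (f t)) (vert (f s)) \<in> B)"
    using A(1) unfolding w_def by blast
qed

text \<open>On the connected overlap the two lifts differ by a constant modulo \<open>B\<close>, and
  the second is shifted by it. Closedness makes the complement of \<open>T1\<close> a neighbourhood
  of every point outside \<open>T1\<close>, and likewise for \<open>T2\<close>.\<close>

lemma lifts_glue:
  assumes T: "closed T1" "closed T2" "connected (T1 \<inter> T2)" and h: "lifts T1 f h1" "lifts T2 f h2"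
  shows "\<exists>h. lifts (T1 \<union> T2) f h"
proof -
  obtain k where k: "Poly_Mapping.keys k \<subseteq> E" "\<And>t. t \<in> T1 \<inter> T2 \<Longrightarrow> h1 t - (h2 t + k) \<in> B"
  proof (cases "T1 \<inter> T2 = {}")
    case True
    then show ?thesis
      using that[of 0] by auto
  next
    case False
    then obtain t0 where t0: "t0 \<in> T1 \<inter> T2"
      by blast
    have h': "lifts (T1 \<inter> T2) f h1" "lifts (T1 \<inter> T2) f h2"
      using lifts_compose[OF h(1) continuous_on_id, of "T1 \<inter> T2"]
        lifts_compose[OF h(2) continuous_on_id, of "T1 \<inter> T2"] by (auto simp: o_def)
    show ?thesis
    proof (rule that[of "h1 t0 - h2 t0"])
      show "Poly_Mapping.keys (h1 t0 - h2 t0) \<subseteq> E"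
        using keys_diff[of "h1 t0" "h2 t0"] lifts_keys[OF h(1)] lifts_keys[OF h(2)] t0 by blast
      show "h1 t - (h2 t + (h1 t0 - h2 t0)) \<in> B" if "t \<in> T1 \<inter> T2" for t
        using lifts_unique[OF T(3) h' that t0] by (simp add: algebra_simps)
    qed
  qed
  define h where "h t = (if t \<in> T1 then h1 t else h2 t + k)" for t
  have h_T2: "h t - (h2 t + k) \<in> B" if "t \<in> T2" for t
    using k(2)[of t] that by (auto simp: h_def frag_image_0)
  have near1: "\<exists>U. open U \<and> t \<in> U \<and> (\<forall>s\<in>T1 \<inter> U. h s - h t - edge (vert (f t)) (vert (f s)) \<in> B)"
    if "t \<in> T1" for t
    using lifts_near[OF h(1) that] that by (simp add: h_def)
  have near2: "\<exists>U. open U \<and> t \<in> U \<and> (\<forall>s\<in>T2 \<inter> U. h s - h t - edge (vert (f t)) (vert (f s)) \<in> B)"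
    if t: "t \<in> T2" for t
  proof -
    obtain U where U: "open U" "t \<in> U" "\<forall>s\<in>T2 \<inter> U. h2 s - h2 t - edge (vert (f t)) (vert (f s)) \<in> B"
      by (rule liftsE[OF h(2) t])
    have "h s - h t - edge (vert (f t)) (vert (f s)) \<in> B" if "s \<in> T2 \<inter> U" for s
    proof -
      have "h s - h t - edge (vert (f t)) (vert (f s))
          = (h s - (h2 s + k)) - (h t - (h2 t + k)) + (h2 s - h2 t - edge (vert (f t)) (vert (f s)))"
        by simp
      also have "\<dots> \<in> B"
        by (intro frag_image_add frag_image_diff[OF h_T2 h_T2] bspec[OF U(3)]) (use that t in auto)
      finally show ?thesis .
    qed
    then show ?thesis
      using U by blast
  qed
  have "lifts (T1 \<union> T2) f h"
    unfolding lifts_def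
  proof (intro conjI ballI)
    fix t assume "t \<in> T1 \<union> T2"
    then show "Poly_Mapping.keys (h t) \<subseteq> E"
      using lifts_keys[OF h(1)] lifts_keys[OF h(2)] k(1) keys_add[of "h2 t" k]
      unfolding h_def by (cases "t \<in> T1") (simp, simp only: if_False Un_iff, blast)
    obtain U1 where U1: "open U1" "t \<in> U1" "\<And>s. s \<in> T1 \<inter> U1 \<Longrightarrow> h s - h t - edge (vert (f t)) (vert (f s)) \<in> B"
    proof (cases "t \<in> T1")
      case True
      then show ?thesis
        using near1 that by blast
    next
      case False
      then show ?thesis
        using that[of "- T1"] T(1) by auto
    qed
    obtain U2 where U2: "open U2" "t \<in> U2" "\<And>s. s \<in> T2 \<inter> U2 \<Longrightarrow> h s - h t - edge (vert (f t)) (vert (f s)) \<in> B"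
    proof (cases "t \<in> T2")
      case True
      then show ?thesis
        using near2 that by blast
    next
      case False
      then show ?thesis
        using that[of "- T2"] T(2) by auto
    qed
    show "\<exists>U. open U \<and> t \<in> U \<and> (\<forall>s\<in>(T1 \<union> T2) \<inter> U. h s - h t - edge (vert (f t)) (vert (f s)) \<in> B)"
      using U1 U2 by (intro exI[of _ "U1 \<inter> U2"]) auto
  qed
  then show ?thesis
    by blast
qed

end

context realized_complex begin

lemma lifts_rectangles_glue:
  fixes A A' B B' :: "real set"
  assumes "lifts (A \<times> B) f h1" "lifts (A' \<times> B') f h2"
    and "closed A" "closed B" "closed A'" "closed B'" "convex A" "convex B" "convex A'" "convex B'"
  shows "\<exists>h. lifts (A \<times> B \<union> A' \<times> B') f h"
proof (rule lifts_glue[OF _ _ _ assms(1,2)])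
  show "closed (A \<times> B)" "closed (A' \<times> B')"
    using assms by (auto intro: closed_Times)
  show "connected (A \<times> B \<inter> A' \<times> B')"
    using assms by (intro convex_connected convex_Int convex_Times)
qed

text \<open>Bisection is used twice: along the second coordinate to build a lift over a thin strip,
  then along the first to join the strips.\<close>

lemma lift_square:
  assumes H: "continuous_on ({0..1} \<times> {0..1}) H" "H ` ({0..1} \<times> {0..1}) \<subseteq> S"
  shows "\<exists>h. lifts ({0..1::real} \<times> {0..1::real}) H h"
proof -
  let ?I = "{0..1::real}"
  let ?R = "\<lambda>a b c d. (?I \<inter> {a..b}) \<times> (?I \<inter> {c..d})"
  \<comment> \<open>By continuity a small rectangle around \<open>(x, y)\<close> is mapped into the
    open star of a single vertex.\<close>
  have small: "\<exists>r>0. \<forall>a b c d. a \<le> x \<and> x \<le> b \<and> b - a < r \<and> c \<le> y \<and> y \<le> d \<and> d - c < r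
      \<longrightarrow> (\<exists>h. lifts (?R a b c d) H h)" if xy: "x \<in> ?I" "y \<in> ?I" for x y
  proof -
    define v where "v = vert (H (x, y))"
    have "0 < H (x, y) v"
      unfolding v_def by (rule vert_pos) (use H(2) xy in auto)
    have "continuous_on (?I \<times> ?I) (\<lambda>z. H z v)"
      using H(1) by (rule continuous_on_product_then_coordinatewise)
    then obtain A where A: "open A" "A \<inter> ?I \<times> ?I = (\<lambda>z. H z v) -` {0<..} \<inter> ?I \<times> ?I"
      unfolding continuous_on_open_invariant by (metis open_greaterThan)
    have "(x, y) \<in> A"
      using A(2) xy \<open>0 < H (x, y) v\<close> by auto
    with A(1) obtain A1 A2 where A12: "open A1" "open A2" "(x, y) \<in> A1 \<times> A2" "A1 \<times> A2 \<subseteq> A"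
      by (rule open_prod_elim)
    have "x \<in> A1" "y \<in> A2"
      using A12(3) by simp_all
    then obtain r1 r2 where r: "r1 > 0" "ball x r1 \<subseteq> A1" "r2 > 0" "ball y r2 \<subseteq> A2"
      using A12(1,2)[unfolded open_contains_ball] by blast
    show ?thesis
    proof (intro exI[of _ "min r1 r2"] conjI allI impI)
      fix a b c d assume *: "a \<le> x \<and> x \<le> b \<and> b - a < min r1 r2 \<and> c \<le> y \<and> y \<le> d \<and> d - c < min r1 r2"
      have "{a..b} \<subseteq> A1"
        using r(2) * by (auto simp: dist_real_def subset_iff)
      moreover have "{c..d} \<subseteq> A2"
        using r(4) * by (auto simp: dist_real_def subset_iff)
      ultimately have "?R a b c d \<subseteq> A"
        using A12(4) by blast
      then have pos: "0 < H z v" if "z \<in> ?R a b c d" for z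
        using A(2) that by blast
      have "?R a b c d \<subseteq> ?I \<times> ?I"
        by blast
      then have "lifts (?R a b c d) H (\<lambda>z. edge v (vert (H z)))"
        using H by (intro lifts_star pos) (blast intro: continuous_on_subset)+
      then show "\<exists>h. lifts (?R a b c d) H h"
        by blast
    qed (use r in auto)
  qed
  have strip: "\<exists>r>0. \<forall>a b. a \<le> x \<and> x \<le> b \<and> b - a < r \<longrightarrow> (\<exists>h. lifts (?R a b 0 1) H h)"
    if x: "x \<in> ?I" for x
  proof -
    \<comment> \<open>The admissible width \<open>r\<close> is part of \<open>Q\<close>, so that
      stacking two boxes can pass to the smaller of their widths.\<close>
    define Q where "Q c d \<longleftrightarrow> (\<exists>r>0. \<forall>a b. a \<le> x \<and> x \<le> b \<and> b - a < r \<longrightarrow> (\<exists>h. lifts (?R a b c d) H h))"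
      for c d
    have "Q 0 1"
      using zero_le_one
    proof (induct rule: Bolzano)
      case (trans c d e)
      obtain r1 where r1: "r1 > 0" "\<forall>a b. a \<le> x \<and> x \<le> b \<and> b - a < r1 \<longrightarrow> (\<exists>h. lifts (?R a b c d) H h)"
        using trans(1) unfolding Q_def by blast
      obtain r2 where r2: "r2 > 0" "\<forall>a b. a \<le> x \<and> x \<le> b \<and> b - a < r2 \<longrightarrow> (\<exists>h. lifts (?R a b d e) H h)"
        using trans(2) unfolding Q_def by blast
      have R: "?R a b c e = ?R a b c d \<union> ?R a b d e" for a b
        using trans(3,4) by auto
      have "\<exists>h. lifts (?R a b c e) H h" if ab: "a \<le> x" "x \<le> b" "b - a < min r1 r2" for a b
      proof -
        have "\<exists>h. lifts (?R a b c d) H h" "\<exists>h. lifts (?R a b d e) H h"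
          using r1(2) r2(2) ab by (simp_all only: min_less_iff_conj conj_assoc simp_thms)
        then obtain h1 h2 where "lifts (?R a b c d) H h1" "lifts (?R a b d e) H h2"
          by blast
        then show ?thesis
          unfolding R by (rule lifts_rectangles_glue) (auto intro: closed_Int convex_Int)
      qed
      then show ?case
        unfolding Q_def using r1(1) r2(1) by (intro exI[of _ "min r1 r2"]) simp
    next
      case (local y)
      then have "y \<in> ?I"
        by simp
      from small[OF x this] obtain r where r: "r > 0"
        "\<forall>a b c d. a \<le> x \<and> x \<le> b \<and> b - a < r \<and> c \<le> y \<and> y \<le> d \<and> d - c < r
          \<longrightarrow> (\<exists>h. lifts (?R a b c d) H h)"
        by blast
      show ?case
        unfolding Q_def using r by (intro exI[of _ r]) blast
    qed
    then show ?thesis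
      by (simp only: Q_def)
  qed
  define P where "P a b \<longleftrightarrow> (\<exists>h. lifts (?R a b 0 1) H h)" for a b
  have "P 0 1"
    using zero_le_one
  proof (induct rule: Bolzano)
    case (trans a b c)
    have R: "?R a c 0 1 = ?R a b 0 1 \<union> ?R b c 0 1"
      using trans(3,4) by auto
    obtain h1 h2 where "lifts (?R a b 0 1) H h1" "lifts (?R b c 0 1) H h2"
      using trans(1,2) unfolding P_def by blast
    then show ?case
      unfolding P_def R by (rule lifts_rectangles_glue) (auto intro: closed_Int convex_Int)
  next
    case (local x)
    then show ?case
      unfolding P_def by (intro strip) simp
  qed
  then show ?thesis
    by (simp add: P_def)
qed

section \<open>Monodromy of paths\<close>

lemma lift_path:
  assumes "path p" "path_image p \<subseteq> S"
  shows "\<exists>h. lifts {0..1} p h"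
proof -
  \<comment> \<open>The path is read as a map on the square that is constant in the first
    coordinate; the lift is then restricted to one side.\<close>
  have "continuous_on ({0..1} \<times> {0..1}) (p \<circ> snd)"
    unfolding o_def
    by (rule continuous_on_compose2[OF assms(1)[unfolded path_def] continuous_on_snd[OF continuous_on_id]]) auto
  moreover have "(p \<circ> snd) ` ({0..1::real} \<times> {0..1}) \<subseteq> S"
    using assms(2) by (auto simp: path_image_def)
  ultimately obtain h where h: "lifts ({0..1::real} \<times> {0..1::real}) (p \<circ> snd) h"
    using lift_square by blast
  have "lifts {0..1} ((p \<circ> snd) \<circ> Pair (0::real)) (h \<circ> Pair (0::real))"
    by (rule lifts_compose[OF h, where g = "Pair 0"]) (auto intro!: continuous_intros)
  then show ?thesis
    by (auto simp: o_def)
qed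

text \<open>A relation and not a function, because lifts, and with them the change along a path, are
  determined only modulo \<open>B\<close>.\<close>

definition path_value :: "(real \<Rightarrow> 'v \<Rightarrow> real) \<Rightarrow> ('v set \<Rightarrow>\<^sub>0 int) \<Rightarrow> bool" where
  "path_value p c \<longleftrightarrow> (\<exists>h. lifts {0..1} p h \<and> c = h 1 - h 0)"

lemma path_value_exists: "path p \<Longrightarrow> path_image p \<subseteq> S \<Longrightarrow> \<exists>c. path_value p c"
  using lift_path by (auto simp: path_value_def)

lemma keys_path_value: "path_value p c \<Longrightarrow> Poly_Mapping.keys c \<subseteq> E"
proof -
  assume "path_value p c"
  then obtain h where h: "lifts {0..1} p h" "c = h 1 - h 0"
    by (auto simp: path_value_def)
  have "Poly_Mapping.keys (h 1) \<subseteq> E" "Poly_Mapping.keys (h 0) \<subseteq> E"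
    by (rule lifts_keys[OF h(1)], simp)+
  then show ?thesis
    using keys_diff[of "h 1" "h 0"] unfolding h(2) by blast
qed

lemma path_value_unique: "path_value p c \<Longrightarrow> path_value p c' \<Longrightarrow> c - c' \<in> B"
proof -
  assume "path_value p c" "path_value p c'"
  then obtain h h' where h: "lifts {0..1} p h" "c = h 1 - h 0" "lifts {0..1} p h'" "c' = h' 1 - h' 0"
    by (auto simp: path_value_def)
  have "(h 1 - h' 1) - (h 0 - h' 0) \<in> B"
    by (rule lifts_unique[OF _ h(1,3)]) (auto intro: convex_connected)
  then show ?thesis
    by (simp add: h(2,4) algebra_simps)
qed

text \<open>A lift over the square of the homotopy restricts to lifts of \<open>p\<close> and
  \<open>q\<close> on two opposite sides. On the other two sides the map is constant, so by
  uniqueness the lift changes there only by an element of \<open>B\<close>.\<close>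

lemma path_value_homotopic:
  assumes "homotopic_paths S p q" "path_value p c" "path_value q c'"
  shows "c - c' \<in> B"
proof -
  obtain H where H: "continuous_on ({0..1} \<times> {0..1}) H" "H \<in> {0..1} \<times> {0..1} \<rightarrow> S"
      "\<forall>x\<in>{0..1}. H (0, x) = p x" "\<forall>x\<in>{0..1}. H (1, x) = q x"
      "\<forall>t\<in>{0..1::real}. pathstart (H \<circ> Pair t) = pathstart p \<and> pathfinish (H \<circ> Pair t) = pathfinish p"
    using iffD1[OF homotopic_paths assms(1)] by (auto simp only:)
  have "H ` ({0..1} \<times> {0..1}) \<subseteq> S"
    using H(2) by auto
  then obtain h where h: "lifts ({0..1} \<times> {0..1}) H h"
    using lift_square[OF H(1)] by blast
  have vertical: "lifts {0..1} (H \<circ> Pair t) (h \<circ> Pair t)" if "t \<in> {0..1}" for t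
    by (rule lifts_compose[OF h, where g = "Pair t"]) (use that in \<open>auto intro!: continuous_intros\<close>)
  have horizontal: "lifts {0..1} (H \<circ> (\<lambda>t. (t, y))) (h \<circ> (\<lambda>t. (t, y)))" if "y \<in> {0..1}" for y
    by (rule lifts_compose[OF h, where g = "\<lambda>t. (t, y)"]) (use that in \<open>auto intro!: continuous_intros\<close>)
  have p: "lifts {0..1} p (h \<circ> Pair 0)"
    by (rule lifts_cong[OF vertical]) (use H(3) in auto)
  have q: "lifts {0..1} q (h \<circ> Pair 1)"
    by (rule lifts_cong[OF vertical]) (use H(4) in auto)
  have const: "h (1, y) - h (0, y) \<in> B" if y: "y = 0 \<or> y = 1" for y
  proof -
    have H_y: "H (t, y) = H (0, y)" if t: "t \<in> {0..1}" for t
    proof -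
      have "H (s, y) = (if y = 0 then pathstart p else pathfinish p)" if "s \<in> {0..1}" for s
        using bspec[OF H(5) that] y by (auto simp: pathstart_def pathfinish_def)
      from this[OF t] this[of 0] show ?thesis
        by simp
    qed
    have "y \<in> {0..1}"
      using y by auto
    then have "lifts {0..1} (\<lambda>_. H (0, y)) (h \<circ> (\<lambda>t. (t, y)))"
      by (rule lifts_cong[OF horizontal]) (simp only: o_apply H_y)
    from lifts_unique[OF _ this lifts_const, of 1 0] show ?thesis
      by (simp add: convex_connected)
  qed
  have "path_value p (h (0, 1) - h (0, 0))"
    unfolding path_value_def by (intro exI[of _ "h \<circ> Pair 0"] conjI p) simp
  then have p_value: "c - (h (0, 1) - h (0, 0)) \<in> B"
    by (rule path_value_unique[OF assms(2)])
  have "path_value q (h (1, 1) - h (1, 0))"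
    unfolding path_value_def by (intro exI[of _ "h \<circ> Pair 1"] conjI q) simp
  then have q_value: "c' - (h (1, 1) - h (1, 0)) \<in> B"
    by (rule path_value_unique[OF assms(3)])
  have "(c - (h (0, 1) - h (0, 0))) - (c' - (h (1, 1) - h (1, 0))) - (h (1, 1) - h (0, 1))
      + (h (1, 0) - h (0, 0)) \<in> B"
    by (rule frag_image_add[OF frag_image_diff[OF frag_image_diff[OF p_value q_value] const] const]) auto
  then show ?thesis
    by (simp add: algebra_simps)
qed

text \<open>A lift of the concatenation restricts, after rescaling, to lifts of its two
  halves.\<close>

lemma path_value_join:
  assumes "path_value p c" "path_value q d" "path_value (p +++ q) e" "pathfinish p = pathstart q"
  shows "e - (c + d) \<in> B"
proof -
  obtain h where h: "lifts {0..1} (p +++ q) h" "e = h 1 - h 0"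
    using assms(3) by (auto simp: path_value_def)
  have "lifts {0..1} ((p +++ q) \<circ> (\<lambda>t. t / 2)) (h \<circ> (\<lambda>t. t / 2))"
    by (rule lifts_compose[OF h(1), where g = "\<lambda>t. t / 2"]) (auto intro!: continuous_intros)
  then have "lifts {0..1} p (h \<circ> (\<lambda>t. t / 2))"
    by (rule lifts_cong) (auto simp: joinpaths_def)
  then have "path_value p (h (1/2) - h 0)"
    unfolding path_value_def by (intro exI[of _ "h \<circ> (\<lambda>t. t / 2)"]) auto
  then have p: "c - (h (1/2) - h 0) \<in> B"
    by (rule path_value_unique[OF assms(1)])
  have "lifts {0..1} ((p +++ q) \<circ> (\<lambda>t. (t + 1) / 2)) (h \<circ> (\<lambda>t. (t + 1) / 2))"
    by (rule lifts_compose[OF h(1), where g = "\<lambda>t. (t + 1) / 2"]) (auto intro!: continuous_intros)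
  then have "lifts {0..1} q (h \<circ> (\<lambda>t. (t + 1) / 2))"
    by (rule lifts_cong) (use assms(4) in \<open>auto simp: joinpaths_def pathstart_def pathfinish_def add_divide_distrib\<close>)
  then have "path_value q (h 1 - h (1/2))"
    unfolding path_value_def by (intro exI[of _ "h \<circ> (\<lambda>t. (t + 1) / 2)"]) auto
  then have q: "d - (h 1 - h (1/2)) \<in> B"
    by (rule path_value_unique[OF assms(2)])
  have "- ((c - (h (1/2) - h 0)) + (d - (h 1 - h (1/2)))) \<in> B"
    by (rule frag_image_uminus[OF frag_image_add[OF p q]])
  then show ?thesis
    by (simp add: h(2) algebra_simps)
qed

end

section \<open>Homotopies in the realization\<close>

text \<open>Paths in the unit interval with common ends are homotopic by convexity. Composing with
  \<open>p\<close> yields the homotopies for inverses, constants and subdivisions uniformly.\<close>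

lemma homotopic_paths_compose_reals:
  assumes p: "path p" "path_image p \<subseteq> S"
    and fg: "path f" "path_image f \<subseteq> {0..1::real}" "path g" "path_image g \<subseteq> {0..1}"
      "pathstart f = pathstart g" "pathfinish f = pathfinish g"
  shows "homotopic_paths S (p \<circ> f) (p \<circ> g)"
proof (rule homotopic_paths_continuous_image)
  show "homotopic_paths {0..1} f g"
  proof (rule homotopic_paths_linear)
    fix t :: real assume "t \<in> {0..1}"
    then have "f t \<in> {0..1}" "g t \<in> {0..1}"
      using fg(2,4) unfolding path_image_def by blast+
    then show "closed_segment (f t) (g t) \<subseteq> {0..1}"
      by (intro closed_segment_subset) auto
  qed (use fg in auto)
qed (use p in \<open>auto simp: path_def path_image_def\<close>)

lemma linepath_0_1_real: "linepath 0 (1::real) = (\<lambda>t. t)"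
  by (auto simp: linepath_def)

lemma compose_linepath_1_0: "p \<circ> linepath 1 (0::real) = reversepath p"
  by (auto simp: linepath_def reversepath_def)

lemma path_linepath_unit:
  "s \<in> {0..1} \<Longrightarrow> t \<in> {0..1} \<Longrightarrow> path_image (linepath s t) \<subseteq> {0..1::real}"
  by (simp add: closed_segment_subset)

lemma homotopic_paths_reverse_right:
  assumes "path p" "path_image p \<subseteq> S"
  shows "homotopic_paths S (p +++ reversepath p) (\<lambda>_. pathstart p)"
proof -
  have "homotopic_paths S (p \<circ> (linepath 0 1 +++ linepath 1 0)) (p \<circ> linepath 0 0)"
    by (rule homotopic_paths_compose_reals[OF assms])
      (auto simp: path_image_join closed_segment_eq_real_ivl)
  then show ?thesis
    unfolding path_compose_join compose_linepath_1_0 linepath_0_1_real by (simp add: o_def pathstart_def)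
qed

lemma homotopic_paths_const_left:
  assumes "path p" "path_image p \<subseteq> S"
  shows "homotopic_paths S ((\<lambda>_. pathstart p) +++ p) p"
proof -
  have "homotopic_paths S (p \<circ> (linepath 0 0 +++ linepath 0 1)) (p \<circ> linepath 0 1)"
    by (rule homotopic_paths_compose_reals[OF assms])
      (auto simp: path_image_join closed_segment_eq_real_ivl)
  then show ?thesis
    unfolding path_compose_join linepath_0_1_real by (simp add: o_def pathstart_def)
qed

section \<open>Segments and cones in barycentric coordinates\<close>

definition seg :: "('v \<Rightarrow> real) \<Rightarrow> ('v \<Rightarrow> real) \<Rightarrow> real \<Rightarrow> 'v \<Rightarrow> real" where
  "seg x y = (\<lambda>t v. (1 - t) * x v + t * y v)"

lemma path_seg: "path (seg x y)"
  unfolding path_def seg_def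
  by (intro continuous_on_coordinatewise_then_product continuous_intros)

lemma seg_ends [simp]: "pathstart (seg x y) = x" "pathfinish (seg x y) = y"
  by (simp_all add: seg_def pathstart_def pathfinish_def)

definition supp :: "('v \<Rightarrow> real) \<Rightarrow> 'v set" where
  "supp x = {v. x v \<noteq> 0}"

definition unit_at :: "'v \<Rightarrow> 'v \<Rightarrow> real" where
  "unit_at v = (\<lambda>u. if u = v then 1 else 0)"

lemma supp_unit_at [simp]: "supp (unit_at v) = {v}"
  by (auto simp: supp_def unit_at_def)

lemma supp_seg: "supp (seg x y t) \<subseteq> supp x \<union> supp y"
  by (auto simp: supp_def seg_def)

context realized_complex begin

lemma unit_at_in: "{v} \<in> X \<Longrightarrow> unit_at v \<in> S"
proof -
  assume "{v} \<in> X"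
  moreover have "{u. unit_at v u \<noteq> 0} = {v}"
    by (auto simp: unit_at_def)
  ultimately show ?thesis
    by (auto simp: complex_realization_def) (auto simp: unit_at_def)
qed

lemma supp_in: "x \<in> S \<Longrightarrow> supp x \<in> X"
  by (simp add: supp_def support_simplex)

lemma face: "\<sigma> \<in> X \<Longrightarrow> \<tau> \<noteq> {} \<Longrightarrow> \<tau> \<subseteq> \<sigma> \<Longrightarrow> \<tau> \<in> X"
  by (rule complex_face[OF X])

lemma simplex_finite: "\<sigma> \<in> X \<Longrightarrow> finite \<sigma>"
  using X by (simp add: finite_simplicial_complex_def)

lemma seg_in:
  assumes x: "x \<in> S" and y: "y \<in> S" and U: "supp x \<union> supp y \<in> X" and t: "t \<in> {0..1}"
  shows "seg x y t \<in> S"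
proof -
  let ?z = "seg x y t"
  have fin: "finite (supp x \<union> supp y)"
    by (rule simplex_finite[OF U])
  have sum1: "sum z (supp x \<union> supp y) = 1" if "z = x \<or> z = y" for z
  proof -
    have "sum z (supp z) = 1"
      using that x y by (auto simp: complex_realization_def supp_def)
    moreover have "sum z (supp x \<union> supp y) = sum z (supp z)"
      using fin that by (intro sum.mono_neutral_right) (auto simp: supp_def)
    ultimately show ?thesis
      by simp
  qed
  have "sum ?z (supp ?z) = sum ?z (supp x \<union> supp y)"
    using fin supp_seg[of x y t] by (intro sum.mono_neutral_left) (auto simp: supp_def)
  also have "\<dots> = (1 - t) * sum x (supp x \<union> supp y) + t * sum y (supp x \<union> supp y)"
    by (simp add: seg_def sum.distrib sum_distrib_left)
  finally have "sum ?z (supp ?z) = 1"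
    by (simp add: sum1)
  moreover from this have "supp ?z \<in> X"
    by (intro face[OF U _ supp_seg]) auto
  moreover have "0 \<le> ?z v" for v
    using t realization_nonneg[OF x] realization_nonneg[OF y] by (simp add: seg_def)
  ultimately show ?thesis
    by (simp add: complex_realization_def supp_def)
qed

definition path_from :: "(real \<Rightarrow> 'v \<Rightarrow> real) \<Rightarrow> ('v \<Rightarrow> real) \<Rightarrow> ('v \<Rightarrow> real) \<Rightarrow> bool" where
  "path_from p x y \<longleftrightarrow> path p \<and> path_image p \<subseteq> S \<and> pathstart p = x \<and> pathfinish p = y"

lemma path_fromD:
  assumes "path_from p x y"
  shows "path p" "path_image p \<subseteq> S" "pathstart p = x" "pathfinish p = y" "x \<in> S" "y \<in> S"
  using assms by (auto simp: path_from_def path_image_def pathstart_def pathfinish_def)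

lemma path_from_in: "path_from p x y \<Longrightarrow> t \<in> {0..1} \<Longrightarrow> p t \<in> S"
  by (auto simp: path_from_def path_image_def)

lemma path_from_join: "path_from p x y \<Longrightarrow> path_from q y z \<Longrightarrow> path_from (p +++ q) x z"
  by (auto simp: path_from_def path_image_join)

lemma path_from_reverse: "path_from p x y \<Longrightarrow> path_from (reversepath p) y x"
  by (auto simp: path_from_def)

lemma path_from_const: "x \<in> S \<Longrightarrow> path_from (\<lambda>_. x) x x"
  by (auto simp: path_from_def path_def path_image_def pathstart_def pathfinish_def)

lemma path_from_seg: "x \<in> S \<Longrightarrow> y \<in> S \<Longrightarrow> supp x \<union> supp y \<in> X \<Longrightarrow> path_from (seg x y) x y"
  using seg_in by (auto simp: path_from_def path_seg path_image_def)

lemma path_from_compose_linepath: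
  assumes "path_from p x y" "s \<in> {0..1}" "t \<in> {0..1}"
  shows "path_from (p \<circ> linepath s t) (p s) (p t)"
proof -
  have sub: "path_image (linepath s t) \<subseteq> {0..1}"
    by (rule path_linepath_unit[OF assms(2,3)])
  then have "path (p \<circ> linepath s t)"
    using path_fromD(1)[OF assms(1)] unfolding path_def[of p]
    by (intro path_continuous_image path_linepath) (rule continuous_on_subset)
  moreover have "path_image (p \<circ> linepath s t) \<subseteq> S"
    using sub path_fromD(2)[OF assms(1)] by (auto simp: path_image_compose path_image_def[of p])
  ultimately show ?thesis
    by (simp add: path_from_def pathstart_compose pathfinish_compose)
qed

lemma homotopic_refl: "path_from p x y \<Longrightarrow> homotopic_paths S p p"
  by (simp add: path_from_def)

lemma homotopic_join:
  "path_from p x y \<Longrightarrow> path_from q y z \<Longrightarrow> homotopic_paths S p p' \<Longrightarrow> homotopic_paths S q q'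
    \<Longrightarrow> homotopic_paths S (p +++ q) (p' +++ q')"
  by (rule homotopic_paths_join) (auto simp: path_from_def)

lemma homotopic_assoc:
  "path_from p x y \<Longrightarrow> path_from q y z \<Longrightarrow> path_from r z w
    \<Longrightarrow> homotopic_paths S ((p +++ q) +++ r) (p +++ (q +++ r))"
  by (rule homotopic_paths_sym, rule homotopic_paths_assoc) (auto simp: path_from_def)

lemma homotopic_reverse_right:
  "path_from p x y \<Longrightarrow> homotopic_paths S (p +++ reversepath p) (\<lambda>_. x)"
  using homotopic_paths_reverse_right[of p S] by (auto simp: path_from_def)

lemma homotopic_reverse_left:
  "path_from p x y \<Longrightarrow> homotopic_paths S (reversepath p +++ p) (\<lambda>_. y)"
  using homotopic_paths_reverse_right[of "reversepath p" S] by (auto simp: path_from_def)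

lemma homotopic_const_left:
  "path_from p x y \<Longrightarrow> homotopic_paths S ((\<lambda>_. x) +++ p) p"
  using homotopic_paths_const_left[of p S] by (auto simp: path_from_def)

lemma homotopic_cancel:
  assumes p: "path_from p x y" and q: "path_from q z y" and r: "path_from r y w"
  shows "homotopic_paths S ((p +++ reversepath q) +++ (q +++ r)) (p +++ r)"
proof -
  note q' = path_from_reverse[OF q]
  have "homotopic_paths S (reversepath q +++ (q +++ r)) ((reversepath q +++ q) +++ r)"
    by (rule homotopic_paths_sym[OF homotopic_assoc[OF q' q r]])
  also have "homotopic_paths S \<dots> ((\<lambda>_. y) +++ r)"
    by (rule homotopic_join[OF path_from_join[OF q' q] r homotopic_reverse_left[OF q] homotopic_refl[OF r]])
  also have "homotopic_paths S \<dots> r"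
    by (rule homotopic_const_left[OF r])
  finally have *: "homotopic_paths S (reversepath q +++ (q +++ r)) r" .
  have "homotopic_paths S ((p +++ reversepath q) +++ (q +++ r)) (p +++ (reversepath q +++ (q +++ r)))"
    by (rule homotopic_assoc[OF p q' path_from_join[OF q r]])
  also have "homotopic_paths S \<dots> (p +++ r)"
    by (rule homotopic_join[OF p path_from_join[OF q' path_from_join[OF q r]] homotopic_refl[OF p] *])
  finally show ?thesis .
qed

lemma homotopic_split:
  assumes "path_from p x y" "s \<in> {0..1}" "t \<in> {0..1}" "u \<in> {0..1}"
  shows "homotopic_paths S (p \<circ> linepath s u) ((p \<circ> linepath s t) +++ (p \<circ> linepath t u))"
  unfolding path_compose_join[symmetric]
  by (rule homotopic_paths_compose_reals[OF path_fromD(1,2)[OF assms(1)]])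
    (use path_linepath_unit assms(2-) in \<open>auto simp: path_image_join\<close>)

text \<open>The map \<open>(s, t) \<mapsto> seg (q t) y s\<close> is \<open>q\<close> on the side
  \<open>s = 0\<close>, while the other three sides give the segment to \<open>y\<close>, the
  constant path and the segment from \<open>y\<close>. Both routes around the convex square are
  homotopic.\<close>

lemma homotopic_cone:
  assumes q: "path_from q x z" and y: "y \<in> S" and U: "\<And>t. t \<in> {0..1} \<Longrightarrow> supp (q t) \<union> supp y \<in> X"
  shows "homotopic_paths S q (seg x y +++ ((\<lambda>_. y) +++ seg y z))"
proof -
  define K where "K = (\<lambda>(s, t). seg (q t) y s)"
  let ?Q = "{0..1::real} \<times> {0..1::real}"
  have convex: "convex ?Q"
    by (intro convex_Times convex_real_interval)
  have "homotopic_paths ?Q (linepath (0, 0) (0, 1))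
      (linepath (0, 0) (1, 0) +++ (linepath (1, 0) (1, 1) +++ linepath (1, 1) (0, 1)))" (is "homotopic_paths _ ?l ?r")
  proof (rule homotopic_paths_linear)
    have line: "path_image (linepath u w) \<subseteq> ?Q" if "u \<in> ?Q" "w \<in> ?Q" for u w
      using closed_segment_subset[OF that convex] by simp
    have image: "path_image ?l \<subseteq> ?Q"
      by (rule line) auto
    have image': "path_image ?r \<subseteq> ?Q"
      by (intro subset_path_image_join line) auto
    fix t :: real assume "t \<in> {0..1}"
    then have "?l t \<in> ?Q" "?r t \<in> ?Q"
      using image image' unfolding path_image_def by blast+
    then show "closed_segment (?l t) (?r t) \<subseteq> ?Q"
      by (rule closed_segment_subset[OF _ _ convex])
  qed auto
  moreover have "continuous_on ?Q K"
  proof -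
    have "continuous_on {0..1} (\<lambda>t. q t v)" for v
      using path_fromD(1)[OF q] unfolding path_def by (rule continuous_on_product_then_coordinatewise)
    then have "continuous_on ?Q (\<lambda>z. q (snd z) v)" for v
      by (rule continuous_on_compose2[OF _ continuous_on_snd[OF continuous_on_id]]) auto
    then show ?thesis
      unfolding K_def seg_def case_prod_beta
      by (intro continuous_on_coordinatewise_then_product continuous_intros)
  qed
  moreover have "K \<in> ?Q \<rightarrow> S"
    using path_from_in[OF q] seg_in[OF _ y U] by (auto simp: K_def)
  ultimately have "homotopic_paths S (K \<circ> ?l) (K \<circ> ?r)"
    by (rule homotopic_paths_continuous_image)
  moreover have "K \<circ> ?l = q"
    by (auto simp: K_def linepath_def seg_def fun_eq_iff)
  moreover have "q 0 = x" "q 1 = z"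
    using path_fromD(3,4)[OF q] by (auto simp: pathstart_def pathfinish_def)
  then have "K \<circ> linepath (0, 0) (1, 0) = seg x y" "K \<circ> linepath (1, 0) (1, 1) = (\<lambda>_. y)"
      "K \<circ> linepath (1, 1) (0, 1) = seg y z"
    by (auto simp: K_def linepath_def seg_def fun_eq_iff algebra_simps)
  ultimately show ?thesis
    by (simp add: path_compose_join)
qed

text \<open>All points of the open star of \<open>v\<close> in \<open>S\<close> are joined to the
  vertex \<open>v\<close> by segments, so every point has an open neighbourhood in \<open>S\<close>
  whose points it can be joined to.\<close>

lemma path_between:
  assumes "connected S" "x \<in> S" "y \<in> S"
  shows "\<exists>p. path_from p x y"
proof (rule connected_equivalence_relation[OF assms, where R = "\<lambda>x y. \<exists>p. path_from p x y"])
  fix x assume x: "x \<in> S"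
  define v where "v = vert x"
  have xv: "0 < x v"
    unfolding v_def by (rule vert_pos[OF x])
  have "continuous_on S (\<lambda>x. x v)"
    by (rule continuous_on_product_then_coordinatewise[OF continuous_on_id])
  then have "openin (top_of_set S) (S \<inter> (\<lambda>x. x v) -` {0<..})"
    by (rule continuous_openin_preimage_gen) auto
  moreover have "\<exists>p. path_from p x y" if y: "y \<in> S \<inter> (\<lambda>x. x v) -` {0<..}" for y
  proof -
    have seg: "path_from (seg w (unit_at v)) w (unit_at v)" if "w \<in> S" "0 < w v" for w
    proof -
      have "v \<in> supp w"
        using that(2) by (simp add: supp_def)
      then have "supp w \<union> supp (unit_at v) = supp w"
        by (simp add: insert_absorb)
      moreover have "{v} \<in> X"
        by (rule face[OF supp_in[OF that(1)]]) (use \<open>v \<in> supp w\<close> in simp_all)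
      ultimately show ?thesis
        using that(1) supp_in[OF that(1)] by (intro path_from_seg unit_at_in) simp_all
    qed
    have "path_from (seg y (unit_at v)) y (unit_at v)"
      by (rule seg) (use y in auto)
    from path_from_join[OF seg[OF x xv] path_from_reverse[OF this]] show ?thesis
      by blast
  qed
  ultimately show "\<exists>T. openin (top_of_set S) T \<and> x \<in> T \<and> (\<forall>y\<in>T. \<exists>p. path_from p x y)"
    using x xv by (intro exI[of _ "S \<inter> (\<lambda>x. x v) -` {0<..}"]) auto
qed (use path_from_reverse path_from_join in blast)+

end

section \<open>Loops and bar chains\<close>

lemma bar_relation:
  assumes "g \<in> carrier G" "h \<in> carrier G"
  shows "frag_of [h] - frag_of [g \<otimes>\<^bsub>G\<^esub> h] + frag_of [g] \<in> frag_image (bar_boundary G 2) (bar_basis G 2)"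
proof -
  have "{1..<2::nat} = {1}"
    by auto
  then have "bar_boundary G 2 [g, h] = frag_of [h] - frag_of [g \<otimes>\<^bsub>G\<^esub> h] + frag_of [g]"
    by (simp add: bar_boundary_def)
  moreover have "[g, h] \<in> bar_basis G 2"
    using assms by (simp add: bar_basis_def)
  ultimately show ?thesis
    using frag_image_superset[of "[g, h]" "bar_basis G 2" "bar_boundary G 2"] by simp
qed

locale complex_with_fundamental_group = realized_complex X for X :: "'v::linorder set set" +
  fixes G :: "('g, 'm) monoid_scheme" (structure) and a :: "'v \<Rightarrow> real"
    and \<theta> :: "(real \<Rightarrow> 'v \<Rightarrow> real) set \<Rightarrow> 'g"
  assumes base: "a \<in> complex_realization X" and conn: "connected (complex_realization X)"
    and iso: "\<theta> \<in> iso (fundamental_group (complex_realization X) a) G"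
begin

definition cls :: "(real \<Rightarrow> 'v \<Rightarrow> real) \<Rightarrow> 'g" where
  "cls p = \<theta> (Collect (homotopic_paths S p))"

lemma loops_at_iff: "p \<in> loops_at S a \<longleftrightarrow> path_from p a a"
  by (auto simp: loops_at_def path_from_def)

lemma Collect_homotopic: "homotopic_paths S p q \<Longrightarrow> Collect (homotopic_paths S p) = Collect (homotopic_paths S q)"
  using homotopic_paths_sym homotopic_paths_trans by blast

lemma cls_homotopic: "homotopic_paths S p q \<Longrightarrow> cls p = cls q"
  by (simp add: cls_def Collect_homotopic)

lemma cls_in: "path_from p a a \<Longrightarrow> Collect (homotopic_paths S p) \<in> carrier (fundamental_group S a)"
  by (simp add: fundamental_group_def loops_at_iff)

lemma cls_closed: "path_from p a a \<Longrightarrow> cls p \<in> carrier G"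
  using iso cls_in unfolding cls_def iso_def hom_def by auto

lemma cls_join:
  assumes p: "path_from p a a" and q: "path_from q a a"
  shows "cls (p +++ q) = cls p \<otimes> cls q"
proof -
  have "{r. \<exists>p'\<in>Collect (homotopic_paths S p). \<exists>q'\<in>Collect (homotopic_paths S q). homotopic_paths S (p' +++ q') r}
      = Collect (homotopic_paths S (p +++ q))"
  proof safe
    fix p' q' r assume *: "homotopic_paths S p p'" "homotopic_paths S q q'" "homotopic_paths S (p' +++ q') r"
    show "homotopic_paths S (p +++ q) r"
      by (rule homotopic_paths_trans[OF homotopic_join[OF p q *(1,2)] *(3)])
  next
    fix r assume "homotopic_paths S (p +++ q) r"
    then show "\<exists>p'\<in>Collect (homotopic_paths S p). \<exists>q'\<in>Collect (homotopic_paths S q). homotopic_paths S (p' +++ q') r"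
      using homotopic_refl[OF p] homotopic_refl[OF q] by blast
  qed
  then have "cls (p +++ q) = \<theta> (Collect (homotopic_paths S p) \<otimes>\<^bsub>fundamental_group S a\<^esub> Collect (homotopic_paths S q))"
    by (simp add: cls_def fundamental_group_def)
  also have "\<dots> = cls p \<otimes> cls q"
    using iso cls_in[OF p] cls_in[OF q] unfolding cls_def iso_def hom_def by auto
  finally show ?thesis .
qed

lemma cls_surj: "g \<in> carrier G \<Longrightarrow> \<exists>p. path_from p a a \<and> cls p = g"
proof -
  assume "g \<in> carrier G"
  also have "carrier G = \<theta> ` carrier (fundamental_group S a)"
    using iso by (simp add: iso_def bij_betw_def)
  also have "\<dots> = cls ` loops_at S a"
    by (simp add: fundamental_group_def image_image cls_def)
  finally show ?thesis
    by (auto simp: loops_at_iff)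
qed

lemma cls_eq_imp_homotopic:
  assumes p: "path_from p a a" and q: "path_from q a a" and "cls p = cls q"
  shows "homotopic_paths S p q"
proof -
  have "inj_on \<theta> (carrier (fundamental_group S a))"
    using iso by (simp add: iso_def bij_betw_def)
  then have "Collect (homotopic_paths S p) = Collect (homotopic_paths S q)"
    using assms(3) cls_in[OF p] cls_in[OF q] unfolding cls_def by (rule inj_onD)
  then show ?thesis
    using homotopic_refl[OF q] by blast
qed

abbreviation "BG \<equiv> frag_image (bar_boundary G 2) (bar_basis G 2)"

definition bar_eq :: "('g list \<Rightarrow>\<^sub>0 int) \<Rightarrow> ('g list \<Rightarrow>\<^sub>0 int) \<Rightarrow> bool" (infix \<open>\<simeq>\<close> 50) where
  "x \<simeq> y \<longleftrightarrow> x - y \<in> BG"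

lemma bar_eq_refl: "x \<simeq> x"
  by (simp add: bar_eq_def frag_image_0)

lemma bar_eq_sym: "x \<simeq> y \<Longrightarrow> y \<simeq> x"
  unfolding bar_eq_def using frag_image_uminus[of "x - y"] by simp

lemma bar_eq_trans [trans]: "x \<simeq> y \<Longrightarrow> y \<simeq> z \<Longrightarrow> x \<simeq> z"
  unfolding bar_eq_def using frag_image_add[of "x - y" _ _ "y - z"] by simp

text \<open>The generic substitution rules for calculations search too long on such terms.\<close>

lemma bar_eq_eq_trans [trans]: "x \<simeq> y \<Longrightarrow> y = z \<Longrightarrow> x \<simeq> z"
  by simp

lemma eq_bar_eq_trans [trans]: "x = y \<Longrightarrow> y \<simeq> z \<Longrightarrow> x \<simeq> z"
  by simp

lemma bar_eq_add: "x \<simeq> y \<Longrightarrow> x' \<simeq> y' \<Longrightarrow> x + x' \<simeq> y + y'"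
  unfolding bar_eq_def using frag_image_add[of "x - y" _ _ "x' - y'"] by (simp add: algebra_simps)

lemma bar_eq_uminus: "x \<simeq> y \<Longrightarrow> - x \<simeq> - y"
  unfolding bar_eq_def using frag_image_uminus[of "x - y"] by (simp add: algebra_simps)

lemma bar_eq_diff: "x \<simeq> y \<Longrightarrow> x' \<simeq> y' \<Longrightarrow> x - x' \<simeq> y - y'"
  using bar_eq_add[OF _ bar_eq_uminus, of x y x' y'] by simp

text \<open>Makes the class of a constant path vanish, since such a path is its own concatenation
  with itself; likewise for a triangle collapsed to a point.\<close>

lemma bar_eq_double: "x \<simeq> x + x \<Longrightarrow> x \<simeq> 0"
  unfolding bar_eq_def using frag_image_uminus[of "x - (x + x)"] by simp

lemma bar_eq_mult: "g \<in> carrier G \<Longrightarrow> h \<in> carrier G \<Longrightarrow> frag_of [g \<otimes> h] \<simeq> frag_of [g] + frag_of [h]"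
  unfolding bar_eq_def using frag_image_uminus[OF bar_relation[of g G h]] by (simp add: algebra_simps)

section \<open>Closing paths up to loops at the base point\<close>

definition tail :: "('v \<Rightarrow> real) \<Rightarrow> real \<Rightarrow> 'v \<Rightarrow> real" where
  "tail x = (SOME p. path_from p a x)"

lemma path_from_tail: "x \<in> S \<Longrightarrow> path_from (tail x) a x"
  unfolding tail_def using someI_ex[OF path_between[OF conn base]] by blast

definition wrap :: "(real \<Rightarrow> 'v \<Rightarrow> real) \<Rightarrow> real \<Rightarrow> 'v \<Rightarrow> real" where
  "wrap p = (tail (pathstart p) +++ p) +++ reversepath (tail (pathfinish p))"

definition path_class :: "(real \<Rightarrow> 'v \<Rightarrow> real) \<Rightarrow> 'g list \<Rightarrow>\<^sub>0 int" where
  "path_class p = frag_of [cls (wrap p)]"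

lemma path_from_wrap: "path_from p x y \<Longrightarrow> path_from (wrap p) a a"
  unfolding wrap_def using path_fromD[of p x y] path_from_tail
  by (metis path_from_join path_from_reverse)

lemma path_class_homotopic:
  assumes p: "path_from p x y" and pq: "homotopic_paths S p q"
  shows "path_class p = path_class q"
proof -
  have ends: "pathstart p = x" "pathfinish p = y" "pathstart q = x" "pathfinish q = y"
    using path_fromD(3,4)[OF p] homotopic_paths_imp_pathstart[OF pq] homotopic_paths_imp_pathfinish[OF pq]
    by simp_all
  note tx = path_from_tail[OF path_fromD(5)[OF p]] and ty = path_from_reverse[OF path_from_tail[OF path_fromD(6)[OF p]]]
  have "homotopic_paths S (wrap p) (wrap q)"
    unfolding wrap_def ends
    by (rule homotopic_join[OF path_from_join[OF tx p] ty homotopic_join[OF tx p homotopic_refl[OF tx] pq]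
          homotopic_refl[OF ty]])
  then show ?thesis
    by (simp add: path_class_def cls_homotopic)
qed

text \<open>In the product of the two closed-up loops the tail to the middle point \<open>y\<close>
  is run back and forth and cancels. The bar relation then turns the product of classes into a
  sum.\<close>

lemma path_class_join:
  assumes p: "path_from p x y" and q: "path_from q y z"
  shows "path_class (p +++ q) \<simeq> path_class p + path_class q"
proof -
  note tx = path_from_tail[OF path_fromD(5)[OF p]] and ty = path_from_tail[OF path_fromD(6)[OF p]]
    and tz = path_from_reverse[OF path_from_tail[OF path_fromD(6)[OF q]]]
  have ends: "pathstart p = x" "pathfinish p = y" "pathstart q = y" "pathfinish q = z"
      "pathstart (p +++ q) = x" "pathfinish (p +++ q) = z"
    using path_fromD(3,4)[OF p] path_fromD(3,4)[OF q] by simp_all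
  let ?A = "tail x" and ?C = "tail y" and ?Z = "reversepath (tail z)"
  have "homotopic_paths S (wrap p +++ wrap q) ((?A +++ p) +++ (q +++ ?Z))"
  proof -
    have "homotopic_paths S (wrap p +++ wrap q) (((?A +++ p) +++ reversepath ?C) +++ (?C +++ (q +++ ?Z)))"
      unfolding wrap_def ends
      by (rule homotopic_join[OF path_from_join[OF path_from_join[OF tx p] path_from_reverse[OF ty]]
            path_from_join[OF path_from_join[OF ty q] tz] homotopic_refl[OF path_from_join[OF path_from_join[OF tx p] path_from_reverse[OF ty]]]
            homotopic_assoc[OF ty q tz]])
    also have "homotopic_paths S \<dots> ((?A +++ p) +++ (q +++ ?Z))"
      by (rule homotopic_cancel[OF path_from_join[OF tx p] ty path_from_join[OF q tz]])
    finally show ?thesis .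
  qed
  also have "homotopic_paths S ((?A +++ p) +++ (q +++ ?Z)) (((?A +++ p) +++ q) +++ ?Z)"
    by (rule homotopic_paths_sym[OF homotopic_assoc[OF path_from_join[OF tx p] q tz]])
  also have "homotopic_paths S (((?A +++ p) +++ q) +++ ?Z) (wrap (p +++ q))"
    unfolding wrap_def ends
    by (rule homotopic_join[OF path_from_join[OF path_from_join[OF tx p] q] tz homotopic_assoc[OF tx p q] homotopic_refl[OF tz]])
  finally have "cls (wrap (p +++ q)) = cls (wrap p) \<otimes> cls (wrap q)"
    by (simp add: cls_homotopic[symmetric] cls_join[OF path_from_wrap[OF p] path_from_wrap[OF q]])
  then show ?thesis
    unfolding path_class_def
    by (simp add: bar_eq_mult cls_closed path_from_wrap[OF p] path_from_wrap[OF q])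
qed

lemma path_class_const: "x \<in> S \<Longrightarrow> path_class (\<lambda>_. x) \<simeq> 0"
proof -
  assume "x \<in> S"
  note c = path_from_const[OF this]
  have "(\<lambda>_. x) +++ (\<lambda>_. x) = (\<lambda>_::real. x)"
    by (simp add: joinpaths_def fun_eq_iff)
  then show ?thesis
    using path_class_join[OF c c] by (intro bar_eq_double) simp
qed

text \<open>The tail at \<open>a\<close> is some loop, not necessarily a constant one, so
  \<open>wrap p\<close> is a conjugate of \<open>p\<close>. Modulo bar boundaries products become
  sums and the conjugation drops out.\<close>

lemma path_class_loop:
  assumes p: "path_from p a a"
  shows "path_class p \<simeq> frag_of [cls p]"
proof -
  let ?t = "tail a" and ?r = "reversepath (tail a)"
  note t = path_from_tail[OF base]
  note r = path_from_reverse[OF t]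
  have mult: "frag_of [cls (u +++ w)] \<simeq> frag_of [cls u] + frag_of [cls w]"
    if "path_from u a a" "path_from w a a" for u w
    using that by (simp add: cls_join bar_eq_mult cls_closed)
  have const: "(\<lambda>_. a) +++ (\<lambda>_. a) = (\<lambda>_::real. a)"
    by (simp add: joinpaths_def fun_eq_iff)
  have "frag_of [cls ?t] + frag_of [cls ?r] \<simeq> frag_of [cls (?t +++ ?r)]"
    by (rule bar_eq_sym[OF mult[OF t r]])
  also have "frag_of [cls (?t +++ ?r)] = frag_of [cls (\<lambda>_. a)]"
    by (simp add: cls_homotopic[OF homotopic_reverse_right[OF t]])
  also have "\<dots> \<simeq> 0"
    using mult[OF path_from_const[OF base] path_from_const[OF base]] unfolding const by (rule bar_eq_double)
  finally have tr: "frag_of [cls ?t] + frag_of [cls ?r] \<simeq> 0" .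
  have "path_class p = frag_of [cls ((?t +++ p) +++ ?r)]"
    using path_fromD(3,4)[OF p] by (simp add: path_class_def wrap_def)
  also have "\<dots> \<simeq> frag_of [cls (?t +++ p)] + frag_of [cls ?r]"
    by (rule mult[OF path_from_join[OF t p] r])
  also have "\<dots> \<simeq> (frag_of [cls ?t] + frag_of [cls p]) + frag_of [cls ?r]"
    by (rule bar_eq_add[OF mult[OF t p] bar_eq_refl])
  also have "\<dots> = (frag_of [cls ?t] + frag_of [cls ?r]) + frag_of [cls p]"
    by (simp add: algebra_simps)
  also have "\<dots> \<simeq> 0 + frag_of [cls p]"
    by (rule bar_eq_add[OF tr bar_eq_refl])
  finally show ?thesis
    by simp
qed

lemma path_class_cone:
  assumes q: "path_from q x z" and y: "y \<in> S" and U: "\<And>t. t \<in> {0..1} \<Longrightarrow> supp (q t) \<union> supp y \<in> X"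
  shows "path_class q \<simeq> path_class (seg x y) + path_class (seg y z)"
proof -
  have "q 0 = x" "q 1 = z"
    using path_fromD(3,4)[OF q] by (auto simp: pathstart_def pathfinish_def)
  then have "supp x \<union> supp y \<in> X" "supp y \<union> supp z \<in> X"
    using U[of 0] U[of 1] by (simp_all add: Un_commute)
  then have sx: "path_from (seg x y) x y" and sz: "path_from (seg y z) y z"
    using path_from_seg path_fromD(5,6)[OF q] y by blast+
  note c = path_from_const[OF y]
  have "path_class q = path_class (seg x y +++ ((\<lambda>_. y) +++ seg y z))"
    by (rule path_class_homotopic[OF q homotopic_cone[OF q y U]])
  also have "\<dots> \<simeq> path_class (seg x y) + path_class ((\<lambda>_. y) +++ seg y z)"
    by (rule path_class_join[OF sx path_from_join[OF c sz]])
  also have "\<dots> \<simeq> path_class (seg x y) + (path_class (\<lambda>_. y) + path_class (seg y z))"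
    by (rule bar_eq_add[OF bar_eq_refl path_class_join[OF c sz]])
  also have "\<dots> \<simeq> path_class (seg x y) + (0 + path_class (seg y z))"
    by (intro bar_eq_add bar_eq_refl path_class_const y)
  finally show ?thesis
    by simp
qed

lemma simplex_nonempty: "\<sigma> \<in> X \<Longrightarrow> \<sigma> \<noteq> {}"
  using X by (simp add: finite_simplicial_complex_def)

text \<open>The side \<open>seg x z\<close> is coned off to the opposite corner \<open>y\<close>,
  which stays inside the simplex spanned by the three supports.\<close>

lemma path_class_triangle:
  assumes "x \<in> S" "y \<in> S" "z \<in> S" "supp x \<union> supp y \<union> supp z \<in> X"
  shows "path_class (seg x z) \<simeq> path_class (seg x y) + path_class (seg y z)"
proof (rule path_class_cone)
  have ne: "supp w \<noteq> {}" if "w \<in> S" for w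
    by (rule simplex_nonempty[OF supp_in[OF that]])
  have "supp x \<union> supp z \<in> X"
    by (rule face[OF assms(4)]) (use ne[OF assms(1)] in auto)
  then show xz: "path_from (seg x z) x z"
    by (rule path_from_seg[OF assms(1,3)])
  show "supp (seg x z t) \<union> supp y \<in> X" if "t \<in> {0..1}" for t
    by (rule face[OF assms(4)]) (use ne[OF assms(2)] supp_seg[of x z t] in auto)
qed (rule assms(2))

lemma path_class_seg_same:
  assumes "x \<in> S"
  shows "path_class (seg x x) \<simeq> 0"
proof -
  have "path_class (seg x x) \<simeq> path_class (seg x x) + path_class (seg x x)"
    using supp_in[OF assms] by (intro path_class_triangle assms) simp
  then show ?thesis
    by (rule bar_eq_double)
qed

lemma path_class_seg_swap:
  assumes "x \<in> S" "y \<in> S" "supp x \<union> supp y \<in> X"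
  shows "path_class (seg y x) \<simeq> - path_class (seg x y)"
proof -
  have "path_class (seg x x) \<simeq> path_class (seg x y) + path_class (seg y x)"
    using assms by (intro path_class_triangle) (simp_all add: Un_commute Un_left_commute)
  then have "path_class (seg x y) + path_class (seg y x) \<simeq> 0"
    using path_class_seg_same[OF assms(1)] bar_eq_sym bar_eq_trans by blast
  then have "path_class (seg x y) + path_class (seg y x) - path_class (seg x y) \<simeq> 0 - path_class (seg x y)"
    by (rule bar_eq_diff[OF _ bar_eq_refl])
  then show ?thesis
    by simp
qed

text \<open>Running from \<open>Min\<close> to \<open>Max\<close> matches the orientation under
  which \<open>edge u v\<close> is \<open>frag_of {u, v}\<close>.\<close>

definition edge_class :: "'v set \<Rightarrow> 'g list \<Rightarrow>\<^sub>0 int" where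
  "edge_class \<sigma> = path_class (seg (unit_at (Min \<sigma>)) (unit_at (Max \<sigma>)))"

lemma edge_class_edge:
  assumes "{u, v} \<in> X"
  shows "frag_extend edge_class (edge u v) \<simeq> path_class (seg (unit_at u) (unit_at v))"
proof -
  have "{u} \<in> X" "{v} \<in> X"
    by (rule face[OF assms]; simp)+
  then have S: "unit_at u \<in> S" "unit_at v \<in> S"
    by (simp_all add: unit_at_in)
  consider "u < v" | "u = v" | "v < u"
    by (rule linorder_cases)
  then show ?thesis
  proof cases
    case 1
    then show ?thesis
      by (simp add: edge_def edge_class_def bar_eq_refl)
  next
    case 2
    then show ?thesis
      using bar_eq_sym[OF path_class_seg_same[OF S(1)]] by simp
  next
    case 3
    then have "edge u v = - frag_of {u, v}" "Min {u, v} = v" "Max {u, v} = u"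
      by (auto simp: edge_def min_def max_def)
    then have "frag_extend edge_class (edge u v) = - path_class (seg (unit_at v) (unit_at u))"
      by (simp add: edge_class_def frag_extend_minus)
    also have "\<dots> \<simeq> path_class (seg (unit_at u) (unit_at v))"
      by (rule bar_eq_sym[OF path_class_seg_swap]) (use S assms in \<open>simp_all add: insert_commute\<close>)
    finally show ?thesis .
  qed
qed

lemma edge_class_boundary:
  assumes "\<sigma> \<in> complex_simplices X 2"
  shows "frag_extend edge_class (simplicial_boundary 2 \<sigma>) \<simeq> 0"
proof -
  have \<sigma>: "\<sigma> \<in> X" "card \<sigma> = 3"
    using assms by (auto simp: complex_simplices_def)
  obtain u v w where uvw: "\<sigma> = {u, v, w}" "u < v" "v < w"
  proof -
    obtain x y z where xyz: "\<sigma> = {x, y, z}" "x \<noteq> y" "y \<noteq> z" "x \<noteq> z"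
      using \<sigma>(2) by (auto simp: card_3_iff)
    have eqs: "\<sigma> = {x, z, y}" "\<sigma> = {y, x, z}" "\<sigma> = {y, z, x}" "\<sigma> = {z, x, y}" "\<sigma> = {z, y, x}"
      unfolding xyz(1) by blast+
    consider "x < y" "y < z" | "x < z" "z < y" | "y < x" "x < z" | "y < z" "z < x" | "z < x" "x < y" | "z < y" "y < x"
      using xyz(2-) by (meson linorder_neqE)
    then show thesis
      by cases (use that xyz(1) eqs in metis)+
  qed
  have X: "{u, v, w} \<in> X"
    using \<sigma> uvw by simp
  have edges: "{u, v} \<in> X" "{v, w} \<in> X" "{u, w} \<in> X" "{u} \<in> X" "{v} \<in> X" "{w} \<in> X"
    by (rule face[OF X]; simp)+
  let ?s = "\<lambda>x y. path_class (seg (unit_at x) (unit_at y))"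
  have tri: "?s u w \<simeq> ?s u v + ?s v w"
    by (rule path_class_triangle) (use edges X in \<open>simp_all add: unit_at_in insert_commute\<close>)
  have "frag_extend edge_class (simplicial_boundary 2 \<sigma>)
      = frag_extend edge_class (edge v w) - frag_extend edge_class (edge u w) + frag_extend edge_class (edge u v)"
    unfolding uvw(1) simplicial_boundary_triangle[OF uvw(2,3)] by (simp add: frag_extend_diff frag_extend_add)
  also have "\<dots> \<simeq> ?s v w - ?s u w + ?s u v"
    by (intro bar_eq_add bar_eq_diff edge_class_edge edges)
  also have "\<dots> = (?s u v + ?s v w) - ?s u w"
    by (simp add: algebra_simps)
  also have "\<dots> \<simeq> ?s u w - ?s u w"
    by (rule bar_eq_diff[OF bar_eq_sym[OF tri] bar_eq_refl])
  finally show ?thesis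
    by simp
qed

lemma edge_class_B: "x \<in> B \<Longrightarrow> frag_extend edge_class x \<simeq> 0"
proof -
  assume "x \<in> B"
  then have "frag_extend edge_class x \<in> BG"
    by (rule frag_image_subset[where f = "frag_extend edge_class" and M = BG, rotated -1])
      (use edge_class_boundary in \<open>auto simp: bar_eq_def frag_extend_diff frag_image_0 frag_image_diff\<close>)
  then show ?thesis
    by (simp add: bar_eq_def)
qed

lemma edge_class_cong:
  assumes "x - y \<in> B"
  shows "frag_extend edge_class x \<simeq> frag_extend edge_class y"
  using edge_class_B[OF assms] by (simp add: bar_eq_def frag_extend_diff)

end

context complex_with_fundamental_group begin

section \<open>Path classes computed from lifts\<close>

lemma vertex_support:
  assumes "x \<in> S"
  shows "supp (unit_at (vert x)) \<subseteq> supp x" "unit_at (vert x) \<in> S"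
proof -
  show sub: "supp (unit_at (vert x)) \<subseteq> supp x"
    using vert_pos[OF assms] by (simp add: supp_def unit_at_def)
  have "{vert x} \<in> X"
    by (rule face[OF supp_in[OF assms]]) (use sub in simp_all)
  then show "unit_at (vert x) \<in> S"
    by (rule unit_at_in)
qed

text \<open>The correction to \<open>path_class p\<close> at an endpoint \<open>x\<close> of \<open>p\<close> that is not a vertex.\<close>

definition spoke :: "('v \<Rightarrow> real) \<Rightarrow> 'g list \<Rightarrow>\<^sub>0 int" where
  "spoke x = path_class (seg (unit_at (vert x)) x)"

text \<open>A path in the open star of \<open>v\<close> can be coned off to the vertex
  \<open>v\<close>. At each end \<open>z\<close> the triangle with corners \<open>vert z\<close>,
  \<open>z\<close> and \<open>v\<close> combines the spoke and the segment to \<open>v\<close> into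
  an edge.\<close>

lemma path_class_in_star:
  assumes p: "path_from p x y" and v: "v = vert c" "c \<in> S"
    and star: "\<And>t. t \<in> {0..1} \<Longrightarrow> 0 < p t v"
  shows "path_class p + spoke x - spoke y \<simeq> frag_extend edge_class (edge (vert x) v + edge v (vert y))"
proof -
  have ends: "x \<in> S" "y \<in> S" "0 < x v" "0 < y v"
    using path_fromD[OF p] star[of 0] star[of 1] by (auto simp: pathstart_def pathfinish_def)
  have v_S: "unit_at v \<in> S"
    using vertex_support(2)[OF v(2)] by (simp add: v(1))
  have cone: "path_class p \<simeq> path_class (seg x (unit_at v)) + path_class (seg (unit_at v) y)"
  proof (rule path_class_cone[OF p v_S])
    fix t :: real assume t: "t \<in> {0..1}"
    have "v \<in> supp (p t)"
      using star[OF t] by (simp add: supp_def)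
    then show "supp (p t) \<union> supp (unit_at v) \<in> X"
      using supp_in[OF path_from_in[OF p t]] by (simp add: insert_absorb)
  qed
  have side: "path_class (seg (unit_at (vert z)) (unit_at v)) \<simeq> spoke z + path_class (seg z (unit_at v))"
      "{vert z, v} \<in> X" "supp z \<union> supp (unit_at v) \<in> X" if z: "z \<in> S" "0 < z v" for z
  proof -
    have "v \<in> supp z"
      using z(2) by (simp add: supp_def)
    then have "supp (unit_at (vert z)) \<union> supp z \<union> supp (unit_at v) = supp z" "supp z \<union> supp (unit_at v) = supp z"
      using vertex_support(1)[OF z(1)] by (simp_all add: insert_absorb)
    then show "path_class (seg (unit_at (vert z)) (unit_at v)) \<simeq> spoke z + path_class (seg z (unit_at v))"
        "supp z \<union> supp (unit_at v) \<in> X"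
      unfolding spoke_def using supp_in[OF z(1)] vertex_support(2)[OF z(1)] z(1) v_S
      by (simp_all only: path_class_triangle)
    show "{vert z, v} \<in> X"
      by (rule positive_simplex[OF z(1)]) (use vert_pos[OF z(1)] z(2) in auto)
  qed
  have x_side: "spoke x + path_class (seg x (unit_at v)) \<simeq> frag_extend edge_class (edge (vert x) v)"
    by (rule bar_eq_trans[OF bar_eq_sym[OF side(1)] bar_eq_sym[OF edge_class_edge]]) (use ends side in auto)
  have y_side: "spoke y + path_class (seg y (unit_at v)) \<simeq> frag_extend edge_class (edge (vert y) v)"
    by (rule bar_eq_trans[OF bar_eq_sym[OF side(1)] bar_eq_sym[OF edge_class_edge]]) (use ends side in auto)
  have swap: "path_class (seg (unit_at v) y) \<simeq> - path_class (seg y (unit_at v))"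
    by (rule path_class_seg_swap) (use ends side v_S in auto)
  have "path_class p + spoke x - spoke y
      \<simeq> path_class (seg x (unit_at v)) + (- path_class (seg y (unit_at v))) + spoke x - spoke y"
    by (rule bar_eq_diff[OF bar_eq_add[OF bar_eq_trans[OF cone bar_eq_add[OF bar_eq_refl swap]] bar_eq_refl] bar_eq_refl])
  also have "\<dots> = (spoke x + path_class (seg x (unit_at v))) - (spoke y + path_class (seg y (unit_at v)))"
    by (simp add: algebra_simps)
  also have "\<dots> \<simeq> frag_extend edge_class (edge (vert x) v) - frag_extend edge_class (edge (vert y) v)"
    by (rule bar_eq_diff[OF x_side y_side])
  also have "\<dots> = frag_extend edge_class (edge (vert x) v + edge v (vert y))"
    by (simp add: frag_extend_add edge_swap[of v "vert y"] frag_extend_minus frag_extend_diff)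
  finally show ?thesis .
qed

text \<open>Both sides are additive under subdivision, the spokes at intermediate points cancelling.
  Bisection therefore reduces the claim to pieces short enough to lie in the open star of
  \<open>vert (p c)\<close>.\<close>

lemma path_class_lift:
  assumes p: "path_from p x y" and h: "lifts {0..1} p h"
  shows "path_class p + spoke x - spoke y \<simeq> frag_extend edge_class (h 1 - h 0)"
proof -
  let ?p = "\<lambda>s t. p \<circ> linepath s t"
  define P where "P s t \<longleftrightarrow> s \<in> {0..1} \<longrightarrow> t \<in> {0..1} \<longrightarrow>
      path_class (?p s t) + spoke (p s) - spoke (p t) \<simeq> frag_extend edge_class (h t - h s)" for s t
  have "P 0 1"
    using zero_le_one
  proof (induct rule: Bolzano)
    case (trans r s t)
    show ?case
      unfolding P_def
    proof (intro impI)
      assume r: "r \<in> {0..1}" and t: "t \<in> {0..1}"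
      then have s: "s \<in> {0..1}"
        using trans(3,4) by auto
      note rs = path_from_compose_linepath[OF p r s] and st = path_from_compose_linepath[OF p s t]
        and rt = path_from_compose_linepath[OF p r t]
      have "path_class (?p r t) \<simeq> path_class (?p r s) + path_class (?p s t)"
        using path_class_homotopic[OF rt homotopic_split[OF p r s t]] path_class_join[OF rs st] by simp
      then have "path_class (?p r t) + spoke (p r) - spoke (p t)
          \<simeq> path_class (?p r s) + path_class (?p s t) + spoke (p r) - spoke (p t)"
        by (intro bar_eq_add bar_eq_diff bar_eq_refl)
      also have "\<dots> = (path_class (?p r s) + spoke (p r) - spoke (p s))
          + (path_class (?p s t) + spoke (p s) - spoke (p t))"
        by (simp add: algebra_simps)
      also have "\<dots> \<simeq> frag_extend edge_class (h s - h r) + frag_extend edge_class (h t - h s)"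
        using trans(1,2) r s t unfolding P_def by (intro bar_eq_add) blast+
      also have "\<dots> = frag_extend edge_class (h t - h r)"
        by (simp add: frag_extend_diff)
      finally show "path_class (?p r t) + spoke (p r) - spoke (p t) \<simeq> frag_extend edge_class (h t - h r)" .
    qed
  next
    case (local c)
    then have c: "c \<in> {0..1}"
      by simp
    define v where "v = vert (p c)"
    have pS: "p t \<in> S" if "t \<in> {0..1}" for t
      by (rule path_from_in[OF p that])
    obtain U where U: "open U" "c \<in> U" "\<forall>s\<in>{0..1} \<inter> U. h s - h c - edge (vert (p c)) (vert (p s)) \<in> B"
      by (rule liftsE[OF h c])
    have "continuous_on {0..1} (\<lambda>t. p t v)"
      using path_fromD(1)[OF p] unfolding path_def by (rule continuous_on_product_then_coordinatewise)
    then obtain A where A: "open A" "A \<inter> {0..1} = (\<lambda>t. p t v) -` {0<..} \<inter> {0..1}"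
      unfolding continuous_on_open_invariant by (metis open_greaterThan)
    have "c \<in> A"
      using A(2) c vert_pos[OF pS[OF c]] by (auto simp: v_def)
    then have "open (U \<inter> A)" "c \<in> U \<inter> A"
      using U(1,2) A(1) by auto
    then obtain d where d: "d > 0" "ball c d \<subseteq> U \<inter> A"
      using open_contains_ball by blast
    show ?case
    proof (intro exI[of _ d] conjI allI impI)
      fix s t assume st: "s \<le> c \<and> c \<le> t \<and> t - s < d"
      show "P s t"
        unfolding P_def
      proof (intro impI)
        assume s: "s \<in> {0..1}" and t: "t \<in> {0..1}"
        have near: "r \<in> U" "0 < p r v" if r: "r \<in> {s..t}" for r
        proof -
          have "r \<in> ball c d" "r \<in> {0..1}"
            using r s t st by (auto simp: dist_real_def)
          then have "r \<in> U" "r \<in> A \<inter> {0..1}"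
            using d(2) by auto
          then show "r \<in> U" "0 < p r v"
            unfolding A(2) by simp_all
        qed
        have st_in: "s \<in> {s..t}" "t \<in> {s..t}"
          using st by auto
        have "path_class (?p s t) + spoke (p s) - spoke (p t)
            \<simeq> frag_extend edge_class (edge (vert (p s)) v + edge v (vert (p t)))"
        proof (rule path_class_in_star[OF path_from_compose_linepath[OF p s t] v_def pS[OF c]])
          fix r :: real assume "r \<in> {0..1}"
          then have "linepath s t r \<in> closed_segment s t"
            by (auto simp: linepath_def closed_segment_def)
          then have "linepath s t r \<in> {s..t}"
            using st by (simp add: closed_segment_eq_real_ivl)
          then show "0 < (?p s t) r v"
            using near(2) by simp
        qed
        also have "\<dots> \<simeq> frag_extend edge_class (h t - h s)"
        proof (rule edge_class_cong)
          \<comment> \<open>The neighbourhood \<open>U\<close> controls differences from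
            \<open>h c\<close> only, so both ends are compared with \<open>c\<close> and the two
            relations are subtracted.\<close>
          have "h s - h c - edge v (vert (p s)) \<in> B" "h t - h c - edge v (vert (p t)) \<in> B"
            using bspec[OF U(3), of s] bspec[OF U(3), of t] near(1)[OF st_in(1)] near(1)[OF st_in(2)] s t
            by (simp_all add: v_def)
          from frag_image_diff[OF this]
          show "edge (vert (p s)) v + edge v (vert (p t)) - (h t - h s) \<in> B"
            by (simp add: edge_swap[of "vert (p s)" v] algebra_simps)
        qed
        finally show "path_class (?p s t) + spoke (p s) - spoke (p t) \<simeq> frag_extend edge_class (h t - h s)" .
      qed
    qed (rule d(1))
  qed
  moreover have "p 0 = x" "p 1 = y" "?p 0 1 = p"
    using path_fromD(3,4)[OF p] by (simp_all add: pathstart_def pathfinish_def linepath_0_1_real o_def)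
  ultimately show ?thesis
    by (simp add: P_def)
qed

text \<open>Takes a list because the generators of the bar complex are lists. The choices of loop
  and lift affect the result only modulo \<open>B\<close>.\<close>

definition loop_value :: "'g list \<Rightarrow> 'v set \<Rightarrow>\<^sub>0 int" where
  "loop_value gs = (SOME c. \<exists>p. path_from p a a \<and> cls p = hd gs \<and> path_value p c)"

lemma loop_value:
  assumes "g \<in> carrier G"
  shows "\<exists>p. path_from p a a \<and> cls p = g \<and> path_value p (loop_value [g])"
proof -
  obtain p where p: "path_from p a a" "cls p = g"
    using cls_surj[OF assms] by blast
  then obtain c where "path_value p c"
    using path_value_exists path_fromD(1,2) by blast
  then have "\<exists>c p. path_from p a a \<and> cls p = g \<and> path_value p c"
    using p by blast
  then show ?thesis
    unfolding loop_value_def list.sel by (rule someI_ex)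
qed

text \<open>The loop chosen for \<open>g \<otimes> h\<close> is homotopic to the concatenation of
  those chosen for \<open>g\<close> and \<open>h\<close>. The left side is the image of the bar
  boundary of \<open>[g, h]\<close>.\<close>

lemma loop_value_mult:
  assumes g: "g \<in> carrier G" and h: "h \<in> carrier G" and gh: "g \<otimes> h \<in> carrier G"
  shows "loop_value [h] - loop_value [g \<otimes> h] + loop_value [g] \<in> B"
proof -
  obtain p where p: "path_from p a a" "cls p = g" "path_value p (loop_value [g])"
    using loop_value[OF g] by blast
  obtain q where q: "path_from q a a" "cls q = h" "path_value q (loop_value [h])"
    using loop_value[OF h] by blast
  obtain r where r: "path_from r a a" "cls r = g \<otimes> h" "path_value r (loop_value [g \<otimes> h])"
    using loop_value[OF gh] by blast
  note pq = path_from_join[OF p(1) q(1)]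
  obtain c where c: "path_value (p +++ q) c"
    using path_value_exists[OF path_fromD(1,2)[OF pq]] by blast
  have "homotopic_paths S (p +++ q) r"
    by (rule cls_eq_imp_homotopic[OF pq r(1)]) (simp add: cls_join[OF p(1) q(1)] p(2) q(2) r(2))
  then have "c - loop_value [g \<otimes> h] \<in> B"
    by (rule path_value_homotopic[OF _ c r(3)])
  moreover have "c - (loop_value [g] + loop_value [h]) \<in> B"
    by (rule path_value_join[OF p(3) q(3) c]) (simp add: path_fromD(3,4)[OF p(1)] path_fromD(3,4)[OF q(1)])
  ultimately show ?thesis
    using frag_image_diff[of "c - loop_value [g \<otimes> h]" _ _ "c - (loop_value [g] + loop_value [h])"]
    by (simp add: algebra_simps)
qed

text \<open>The left inverse property: for a loop the spokes at its two ends are both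
  \<open>spoke a\<close> and cancel in \<open>path_class_lift\<close>.\<close>

lemma edge_class_loop_value:
  assumes "g \<in> carrier G"
  shows "frag_extend edge_class (loop_value [g]) \<simeq> frag_of [g]"
proof -
  obtain p where p: "path_from p a a" "cls p = g" "path_value p (loop_value [g])"
    using loop_value[OF assms] by blast
  then obtain h where h: "lifts {0..1} p h" "loop_value [g] = h 1 - h 0"
    unfolding path_value_def by blast
  have "path_class p \<simeq> frag_extend edge_class (h 1 - h 0)"
    using path_class_lift[OF p(1) h(1)] by simp
  then show ?thesis
    using bar_eq_trans[OF bar_eq_sym path_class_loop[OF p(1)]] by (simp add: h(2) p(2))
qed

theorem two_log_torsion_group_homology_le:
  assumes "group G"
  shows "2 * log 3 (real (card (torsion_elements (group_homology 1 G)))) \<le> real (card (complex_simplices X 2))"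
  unfolding group_homology_def
proof (rule two_log_torsion_retract_le[OF X, where \<phi> = loop_value and \<psi> = edge_class])
  fix gs assume "gs \<in> bar_basis G 1"
  then obtain g where g: "gs = [g]" "g \<in> carrier G"
    by (auto simp: bar_basis_def length_Suc_conv)
  show "Poly_Mapping.keys (loop_value gs) \<subseteq> E"
    using loop_value[OF g(2)] keys_path_value unfolding g(1) by blast
  show "frag_extend edge_class (loop_value gs) - frag_of gs \<in> frag_image (bar_boundary G (Suc 1)) (bar_basis G (Suc 1))"
    using edge_class_loop_value[OF g(2)] unfolding g(1) bar_eq_def by (simp add: numeral_2_eq_2)
next
  fix gs assume "gs \<in> bar_basis G (Suc 1)"
  then obtain g h where gh: "gs = [g, h]" "g \<in> carrier G" "h \<in> carrier G"
    by (auto simp: bar_basis_def length_Suc_conv)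
  have "{1..<2::nat} = {1}"
    by auto
  then have "bar_boundary G (Suc 1) gs = frag_of [h] - frag_of [g \<otimes> h] + frag_of [g]"
    by (simp add: bar_boundary_def gh(1) numeral_2_eq_2)
  then show "frag_extend loop_value (bar_boundary G (Suc 1) gs) \<in> B"
    using loop_value_mult[OF gh(2,3)] group.is_monoid[OF assms] gh(2,3)
    by (simp add: frag_extend_add frag_extend_diff monoid.m_closed)
next
  fix \<sigma> assume "\<sigma> \<in> complex_simplices X 2"
  then show "frag_extend edge_class (simplicial_boundary 2 \<sigma>) \<in> frag_image (bar_boundary G (Suc 1)) (bar_basis G (Suc 1))"
    using edge_class_boundary unfolding bar_eq_def by (simp add: numeral_2_eq_2)
qed

end

text \<open>\<open>enat\<close> is well-ordered, so the complexity is attained by an actual complex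
  as soon as one exists.\<close>

lemma Inf_enat_in: "A \<noteq> {} \<Longrightarrow> Inf A \<in> A" for A :: "enat set"
  unfolding Inf_enat_def using LeastI[of "\<lambda>x. x \<in> A"] by auto

theorem proposition2p2:
  shows "(\<forall>X :: 'v::linorder set set.
            finite_simplicial_complex X \<and> complex_dim X = 2 \<longrightarrow>
            real (card (complex_simplices X 2))
              \<ge> 2 * log 3 (real (card (torsion_elements (simplicial_homology 1 X)))))
       \<and> (\<forall>G :: ('g, 'm) monoid_scheme.
            group G \<and> finitely_presentable G \<longrightarrow>
            ereal_of_enat (simplicial_complexity G)
              \<ge> ereal (2 * log 3 (real (card (torsion_elements (group_homology 1 G))))))"
proof (intro conjI allI impI)
  fix X :: "'v set set"
  assume "finite_simplicial_complex X \<and> complex_dim X = 2"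
  then show "real (card (complex_simplices X 2))
      \<ge> 2 * log 3 (real (card (torsion_elements (simplicial_homology 1 X))))"
    using two_log_torsion_simplicial_homology_le by blast
next
  fix G :: "('g, 'm) monoid_scheme"
  assume "group G \<and> finitely_presentable G"
  then have G: "group G" ..
  let ?t = "2 * log 3 (real (card (torsion_elements (group_homology 1 G))))"
  let ?K = "{enat (card (complex_simplices X 2)) | X :: nat set set.
            finite_simplicial_complex X \<and> complex_dim X \<le> 2 \<and>
            connected (complex_realization X) \<and>
            (\<exists>a\<in>complex_realization X. fundamental_group (complex_realization X) a \<cong> G)}"
  have complexity: "simplicial_complexity G = Inf ?K"
    by (simp only: simplicial_complexity_def)
  show "ereal ?t \<le> ereal_of_enat (simplicial_complexity G)"
  proof (cases "?K = {}")
    case True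
    \<comment> \<open>The infimum of the empty set is \<open>\<infinity>\<close>, and the bound
      holds trivially.\<close>
    have "simplicial_complexity G = \<infinity>"
      unfolding complexity True by (simp add: Inf_enat_def)
    then show ?thesis
      by simp
  next
    case False
    have "simplicial_complexity G \<in> ?K"
      unfolding complexity by (rule Inf_enat_in[OF False])
    then have "\<exists>X :: nat set set. simplicial_complexity G = enat (card (complex_simplices X 2)) \<and>
        finite_simplicial_complex X \<and> complex_dim X \<le> 2 \<and> connected (complex_realization X) \<and>
        (\<exists>a\<in>complex_realization X. fundamental_group (complex_realization X) a \<cong> G)"
      by (simp only: mem_Collect_eq)
    then obtain X :: "nat set set" where Y: "simplicial_complexity G = enat (card (complex_simplices X 2)) \<and>
        finite_simplicial_complex X \<and> complex_dim X \<le> 2 \<and> connected (complex_realization X) \<and>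
        (\<exists>a\<in>complex_realization X. fundamental_group (complex_realization X) a \<cong> G)" ..
    then obtain a where a: "a \<in> complex_realization X" "fundamental_group (complex_realization X) a \<cong> G"
      by blast
    then obtain \<theta> where "\<theta> \<in> iso (fundamental_group (complex_realization X) a) G"
      unfolding is_iso_def by blast
    then interpret complex_with_fundamental_group X G a \<theta>
      using Y a by unfold_locales simp_all
    show ?thesis
      using two_log_torsion_group_homology_le[OF G] by (simp add: conjunct1[OF Y])
  qed
qed

end
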